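(* Let $K\subseteq\mathbf{R}^d$ be an arbitrary convex body. Then after possibly translating and scaling $K$, there exist a graded linear series $W_\bullet$ on $\mathbf{P}^d$ associated to the hyperplane divisor, and an admissible flag $Y_\bullet$ on $\mathbf{P}^d$, such that $K=\Delta(W_\bullet)=\Delta_{Y_\bullet}(W_\bullet)$.
   Context: The ground field $\mathbf{K}$ is an uncountable algebraically closed field of arbitrary characteristic. A convex body is a compact convex set with non-empty interior. A graded linear series $W_\bullet$ on a variety $X$ associated to a divisor $D$ consists of finite-dimensional subspaces $W_m\subseteq H^0(X,\mathcal{O}_X(mD))$ for $m\ge0$, with $W_0=\mathbf{K}$ and $W_k\cdot W_\ell\subseteq W_{k+\ell}$. An admissible flag on a $d$-dimensional variety $X$ is $X=Y_0\supseteq Y_1\supseteq\cdots\supseteq Y_d=\{\mathrm{pt}\}$ with $Y_i$ irreducible of codimension $i$ and non-singular at the point $Y_d$. For $0\ne s\in H^0(X,\mathcal{O}_X(B))$ the vector $\nu_{Y_\bullet}(s)=(\nu_1(s),\dots,\nu_d(s))\in\mathbf{Z}^d$ is defined (near $Y_d$, where each $Y_{i+1}$ may be assumed Cartier in $Y_i$) by $\nu_1=\mathrm{ord}_{Y_1}(s)$; divide $s$ by the $\nu_1$-th power of a local equation of $Y_1$ and restrict to $Y_1$ to get $s_1\ne 0$; $\nu_2=\mathrm{ord}_{Y_2}(s_1)$; and so on. The Okounkov body $\Delta_{Y_\bullet}(W_\bullet)\subseteq\mathbf{R}^d$ is the intersection with $\mathbf{R}^d\times\{1\}$ of the closed convex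 cone in $\mathbf{R}^{d+1}$ spanned by $\Gamma(W_\bullet)=\{(\nu_{Y_\bullet}(s),m)\mid 0\ne s\in W_m,\ m\ge0\}$. *)

theory Defs
  imports
    "HOL-Analysis.Analysis"
    "HOL-Library.Poly_Mapping"
    "HOL-Library.Extended_Nat"
    "HOL-Computational_Algebra.Fraction_Field"
begin

section \<open>Homogeneous forms and projective space\<close>

text \<open>Polynomials in variables \<open>x\<^sub>0, x\<^sub>1, \<dots>\<close>: finitely supported maps from exponent vectors
  to coefficients.\<close>

type_synonym 'k poly_ring = "(nat \<Rightarrow>\<^sub>0 nat) \<Rightarrow>\<^sub>0 'k"

type_synonym 'k proj_point = "(nat \<Rightarrow> 'k) set"

definition mpoly_scale :: "'k::field \<Rightarrow> 'k poly_ring \<Rightarrow> 'k poly_ring" where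
  "mpoly_scale c p = Poly_Mapping.single 0 c * p"

interpretation mpoly_vs: vector_space mpoly_scale
  by unfold_locales
     (simp_all add: mpoly_scale_def algebra_simps single_add mult_single flip: mult.assoc)

definition pvar :: "nat \<Rightarrow> 'k::field poly_ring" where
  "pvar j = Poly_Mapping.single (Poly_Mapping.single j 1) 1"

definition eval_poly :: "'k::field poly_ring \<Rightarrow> (nat \<Rightarrow> 'k) \<Rightarrow> 'k" where
  "eval_poly p v =
     (\<Sum>\<mu>\<in>Poly_Mapping.keys p. Poly_Mapping.lookup p \<mu> *
        (\<Prod>j\<in>Poly_Mapping.keys \<mu>. v j ^ Poly_Mapping.lookup \<mu> j))"

text \<open>\<open>H\<^sup>0(P\<^sup>d, O(m))\<close>: the forms of degree \<open>m\<close> in \<open>x\<^sub>0, \<dots>, x\<^sub>d\<close>.\<close>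

definition forms :: "nat \<Rightarrow> nat \<Rightarrow> 'k::field poly_ring set" where
  "forms d m = {p. \<forall>\<mu>\<in>Poly_Mapping.keys p. Poly_Mapping.keys \<mu> \<subseteq> {..d} \<and>
                    (\<Sum>j\<in>Poly_Mapping.keys \<mu>. Poly_Mapping.lookup \<mu> j) = m}"

text \<open>A point of \<open>P\<^sup>d\<close> is the set of all of its homogeneous coordinate vectors
  \<open>(v 0, \<dots>, v d)\<close>; entries beyond index \<open>d\<close> are padded with zero.\<close>

definition proj_space :: "nat \<Rightarrow> 'k::field proj_point set" where
  "proj_space d = (\<lambda>v. {(\<lambda>j. c * v j) | c. c \<noteq> 0}) ` {v. v \<noteq> (\<lambda>_. 0) \<and> (\<forall>j>d. v j = 0)}"

definition vanishes_on :: "'k::field poly_ring \<Rightarrow> 'k proj_point set \<Rightarrow> bool" where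
  "vanishes_on F Z \<longleftrightarrow> (\<forall>P\<in>Z. \<forall>v\<in>P. eval_poly F v = 0)"

definition zariski_closed :: "nat \<Rightarrow> 'k::field proj_point set \<Rightarrow> bool" where
  "zariski_closed d Z \<longleftrightarrow>
     (\<exists>S. S \<subseteq> (\<Union>m. forms d m) \<and> Z = {P \<in> proj_space d. \<forall>F\<in>S. vanishes_on F {P}})"

definition subvariety :: "nat \<Rightarrow> 'k::field proj_point set \<Rightarrow> bool" where
  "subvariety d Z \<longleftrightarrow> zariski_closed d Z \<and> Z \<noteq> {} \<and>
     (\<forall>A B. zariski_closed d A \<and> zariski_closed d B \<and> Z = A \<union> B \<longrightarrow> Z = A \<or> Z = B)"

text \<open>The codimension of \<open>Z\<close> in \<open>Y\<close>: the supremum of the lengths \<open>n\<close> of chains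
  \<open>Z = C\<^sub>0 \<subset> C\<^sub>1 \<subset> \<dots> \<subset> C\<^sub>n \<subseteq> Y\<close> of irreducible closed sets.\<close>

definition codim :: "nat \<Rightarrow> 'k::field proj_point set \<Rightarrow> 'k proj_point set \<Rightarrow> enat" where
  "codim d Z Y = Sup {enat n | n. \<exists>C. C 0 = Z \<and> C n \<subseteq> Y \<and>
     (\<forall>i\<le>n. subvariety d (C i)) \<and> (\<forall>i<n. C i \<subset> C (Suc i))}"


section \<open>Local rings\<close>

text \<open>For subvarieties \<open>Z \<subseteq> Y\<close> of \<open>P\<^sup>d\<close>, \<open>loc_ring d Z\<close> is the local ring of \<open>P\<^sup>d\<close> along \<open>Z\<close>
  (at the generic point of \<open>Z\<close>; at \<open>P\<close> itself if \<open>Z = {P}\<close>), inside the fraction field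
  of the polynomial ring, and \<open>loc_ideal d Z Y\<close> is the ideal of \<open>Y\<close> in it. The local ring
  \<open>O\<^bsub>Y,Z\<^esub>\<close> of \<open>Y\<close> along \<open>Z\<close> is the quotient of the former by the latter; its elements
  are represented by their lifts to \<open>loc_ring d Z\<close>, and its maximal ideal is the image of
  \<open>loc_ideal d Z Z\<close>.\<close>

definition loc_ring :: "nat \<Rightarrow> 'k::field proj_point set \<Rightarrow> 'k poly_ring fract set" where
  "loc_ring d Z = {Fract F G | F G m. F \<in> forms d m \<and> G \<in> forms d m \<and> \<not> vanishes_on G Z}"

definition loc_ideal ::
  "nat \<Rightarrow> 'k::field proj_point set \<Rightarrow> 'k proj_point set \<Rightarrow> 'k poly_ring fract set" where
  "loc_ideal d Z Y = {Fract F G | F G m. F \<in> forms d m \<and> G \<in> forms d m \<and>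
                        vanishes_on F Y \<and> \<not> vanishes_on G Z}"

text \<open>\<open>Y\<close> is non-singular at \<open>P\<close> iff the local ring \<open>O\<^bsub>Y,P\<^esub>\<close> is regular: its maximal ideal is
  generated by \<open>r\<close> elements, where \<open>r\<close> is its Krull dimension, i.e. the codimension of \<open>P\<close>
  in \<open>Y\<close>.\<close>

definition nonsingular_at :: "nat \<Rightarrow> 'k::field proj_point set \<Rightarrow> 'k proj_point \<Rightarrow> bool" where
  "nonsingular_at d Y P \<longleftrightarrow>
     (\<exists>r t. codim d {P} Y = enat r \<and> (\<forall>i<r. t i \<in> loc_ideal d {P} {P}) \<and>
        (\<forall>f\<in>loc_ideal d {P} {P}. \<exists>a. (\<forall>i<r. a i \<in> loc_ring d {P}) \<and>
           f - (\<Sum>i<r. a i * t i) \<in> loc_ideal d {P} Y))"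

text \<open>For \<open>Z \<subseteq> D \<subseteq> Y\<close>: the class of \<open>t\<close> generates the ideal of \<open>D\<close> in \<open>O\<^bsub>Y,Z\<^esub>\<close>. For \<open>Z = {P}\<close>
  this says that \<open>t\<close> is a local equation of \<open>D\<close> in \<open>Y\<close> at \<open>P\<close>; for \<open>Z = D\<close> it says that \<open>t\<close> is
  a uniformizer of \<open>O\<^bsub>Y,D\<^esub>\<close>.\<close>

definition local_equation :: "nat \<Rightarrow> 'k::field proj_point set \<Rightarrow> 'k proj_point set \<Rightarrow>
    'k proj_point set \<Rightarrow> 'k poly_ring fract \<Rightarrow> bool" where
  "local_equation d Z Y D t \<longleftrightarrow> t \<in> loc_ideal d Z D \<and>
     (\<forall>f\<in>loc_ideal d Z D. \<exists>a\<in>loc_ring d Z. f - a * t \<in> loc_ideal d Z Y)"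

text \<open>The order of vanishing along \<open>D\<close> of the class of \<open>f\<close> on \<open>Y\<close>, i.e. its valuation in the
  discrete valuation ring \<open>O\<^bsub>Y,D\<^esub>\<close>: the class of \<open>f\<close> is a unit times the \<open>k\<close>-th power of a
  uniformizer.\<close>

definition ord_along :: "nat \<Rightarrow> 'k::field proj_point set \<Rightarrow> 'k proj_point set \<Rightarrow>
    'k poly_ring fract \<Rightarrow> nat" where
  "ord_along d Y D f = (THE k. \<exists>t u. local_equation d D Y D t \<and>
     u \<in> loc_ring d D \<and> u \<notin> loc_ideal d D D \<and> f - u * t ^ k \<in> loc_ideal d D Y)"


section \<open>Admissible flags and the valuation of a section\<close>

definition admissible_flag :: "nat \<Rightarrow> (nat \<Rightarrow> 'k::field proj_point set) \<Rightarrow> bool" where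
  "admissible_flag d Y \<longleftrightarrow>
     Y 0 = proj_space d \<and>
     (\<forall>i<d. Y (Suc i) \<subseteq> Y i) \<and>
     (\<forall>i\<le>d. subvariety d (Y i) \<and> codim d (Y i) (proj_space d) = enat i) \<and>
     (\<exists>P. Y d = {P} \<and> (\<forall>i\<le>d. nonsingular_at d (Y i) P))"

text \<open>A form \<open>s\<close> of degree \<open>m\<close> becomes a regular function near a point on dividing by \<open>x\<^sub>j\<^sup>m\<close>,
  with \<open>x\<^sub>j\<close> the first coordinate that does not vanish there.\<close>

definition trivialize :: "'k::field proj_point set \<Rightarrow> nat \<Rightarrow> 'k poly_ring \<Rightarrow> 'k poly_ring fract" where
  "trivialize Z m s = Fract s (pvar (LEAST j. \<not> vanishes_on (pvar j) Z) ^ m)"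

text \<open>The successive restrictions \<open>s\<^sub>i\<close> of \<open>s\<close> to \<open>Y\<^sub>i\<close>, as lifts to the local ring of \<open>P\<^sup>d\<close> at the
  point \<open>Y\<^sub>d\<close>: on \<open>Y\<^sub>i\<close>, \<open>s\<^sub>i\<close> equals \<open>s\<^sub>i\<^sub>+\<^sub>1\<close> times the power of a local equation of \<open>Y\<^sub>i\<^sub>+\<^sub>1\<close> whose
  exponent is the order of \<open>s\<^sub>i\<close> along \<open>Y\<^sub>i\<^sub>+\<^sub>1\<close>. For an admissible flag and \<open>s \<noteq> 0\<close> the choices
  made affect the restriction of \<open>s\<^sub>i\<close> to \<open>Y\<^sub>i\<close> only by a unit, hence not the orders.\<close>

primrec flag_germ :: "nat \<Rightarrow> (nat \<Rightarrow> 'k::field proj_point set) \<Rightarrow> nat \<Rightarrow> 'k poly_ring \<Rightarrow>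
    nat \<Rightarrow> 'k poly_ring fract" where
  "flag_germ d Y m s 0 = trivialize (Y d) m s"
| "flag_germ d Y m s (Suc i) =
     (SOME g. g \<in> loc_ring d (Y d) \<and>
        (\<exists>t. local_equation d (Y d) (Y i) (Y (Suc i)) t \<and>
           flag_germ d Y m s i - t ^ ord_along d (Y i) (Y (Suc i)) (flag_germ d Y m s i) * g
             \<in> loc_ideal d (Y d) (Y i)))"

text \<open>Indexed from zero: \<open>flag_val d Y m s i\<close> is \<open>\<nu>\<^sub>i\<^sub>+\<^sub>1(s)\<close>.\<close>

definition flag_val :: "nat \<Rightarrow> (nat \<Rightarrow> 'k::field proj_point set) \<Rightarrow> nat \<Rightarrow> 'k poly_ring \<Rightarrow>
    nat \<Rightarrow> nat" where
  "flag_val d Y m s i = ord_along d (Y i) (Y (Suc i)) (flag_germ d Y m s i)"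


section \<open>Graded linear series and Okounkov bodies\<close>

definition graded_linear_series :: "nat \<Rightarrow> (nat \<Rightarrow> 'k::field poly_ring set) \<Rightarrow> bool" where
  "graded_linear_series d W \<longleftrightarrow>
     (\<forall>m. W m \<subseteq> forms d m \<and> mpoly_vs.subspace (W m) \<and>
          (\<exists>B. finite B \<and> W m = mpoly_vs.span B)) \<and>
     W 0 = {Poly_Mapping.single 0 c | c. True} \<and>
     (\<forall>k l. \<forall>f\<in>W k. \<forall>g\<in>W l. f * g \<in> W (k + l))"

text \<open>\<open>R\<^sup>d\<close> is \<open>real ^ 'n\<close> with \<open>d = CARD('n)\<close>; the linear order of \<open>'n\<close> fixes which coordinate is the
  first, the second, and so on, and \<open>coord_no\<close> numbers them \<open>0, \<dots>, d - 1\<close>.\<close>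

definition coord_no :: "'n::{finite,linorder} \<Rightarrow> nat" where
  "coord_no i = card {j. j < i}"

definition flag_val_vec :: "(nat \<Rightarrow> 'k::field proj_point set) \<Rightarrow> nat \<Rightarrow> 'k poly_ring \<Rightarrow>
    real ^ 'n::{finite,linorder}" where
  "flag_val_vec Y m s = (\<chi> i. real (flag_val CARD('n) Y m s (coord_no i)))"

definition graded_semigroup :: "(nat \<Rightarrow> 'k::field proj_point set) \<Rightarrow>
    (nat \<Rightarrow> 'k poly_ring set) \<Rightarrow> ((real ^ 'n::{finite,linorder}) \<times> real) set" where
  "graded_semigroup Y W = {(flag_val_vec Y m s, real m) | m s. s \<in> W m \<and> s \<noteq> 0}"

definition okounkov_body :: "(nat \<Rightarrow> 'k::field proj_point set) \<Rightarrow>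
    (nat \<Rightarrow> 'k poly_ring set) \<Rightarrow> (real ^ 'n::{finite,linorder}) set" where
  "okounkov_body Y W = {x. (x, 1) \<in> closure (convex_cone hull (graded_semigroup Y W))}"

definition convex_body :: "'a::euclidean_space set \<Rightarrow> bool" where
  "convex_body K \<longleftrightarrow> compact K \<and> convex K \<and> interior K \<noteq> {}"

end

theory Submission
  imports Defs
begin

text \<open>Scale and translate \<open>K\<close> into the simplex \<open>x\<^sub>i \<ge> 0, \<Sum> x\<^sub>i \<le> 1\<close>, and let \<open>W\<^sub>m\<close> be spanned by the
  monomials \<open>x\<^sub>0\<^bsup>m-|a|\<^esup> x\<^sub>1\<^bsup>a(1)\<^esup> \<dots> x\<^sub>d\<^bsup>a(d)\<^esup>\<close> with \<open>a \<in> m K\<close>; convexity of \<open>K\<close> makes this a graded linear series. For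
  the flag of linear subspaces \<open>Y\<^sub>i = {x\<^sub>1 = \<dots> = x\<^sub>i = 0}\<close> the valuation of a form is the
  lexicographically smallest exponent vector in its support, so all valuation vectors of \<open>W\<^sub>m\<close> lie in
  \<open>m K\<close> and every lattice point of \<open>m K\<close> occurs. Rational points are dense in the interior of \<open>K\<close>,
  hence the Okounkov body is \<open>K\<close>.\<close>

section \<open>Evaluation of polynomials\<close>

text \<open>Two features of the definitions shape the proof. \<open>codim\<close> is a supremum over
  chains of irreducible closed sets, so even a linear subspace needs an upper bound on the length of
  arbitrary chains; the bound comes from counting monomials in forms attached to a chain, and a
  chain between two flag members is completed at both ends by the flag itself.
  \<open>flag_germ\<close> picks each restriction by \<open>SOME\<close>, so an invariant is needed
  that holds for every admissible choice. Minimality of the valuation is bypassed: it suffices that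
  \<open>flag_val\<close> is the exponent of some monomial of \<open>s\<close>, since all of these
  lie in \<open>m K\<close>, and a single monomial leaves only one candidate. The coordinate
  \<open>x_0\<close> stays out of the flag: it does not vanish at the point and it fills up degrees.
  The bound 1 on coordinate sums is what leaves room for its exponent \<open>m - |a|\<close>.
  Infinitude of the field lets a form be recovered from its values, so ideals of linear subspaces
  can be read off monomials.\<close>

definition monom_val :: "(nat \<Rightarrow> 'k::field) \<Rightarrow> (nat \<Rightarrow>\<^sub>0 nat) \<Rightarrow> 'k" where
  "monom_val v \<mu> = (\<Prod>j\<in>Poly_Mapping.keys \<mu>. v j ^ Poly_Mapping.lookup \<mu> j)"

definition total_degree :: "(nat \<Rightarrow>\<^sub>0 nat) \<Rightarrow> nat" where
  "total_degree \<mu> = (\<Sum>j\<in>Poly_Mapping.keys \<mu>. Poly_Mapping.lookup \<mu> j)"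

lemma poly_mapping_eq_sum_single:
  "p = (\<Sum>\<mu>\<in>Poly_Mapping.keys p. Poly_Mapping.single \<mu> (Poly_Mapping.lookup p \<mu>))"
  by (rule poly_mapping_eqI)
     (auto simp: lookup_sum lookup_single when_def in_keys_iff sum.delta' if_distrib cong: if_cong)

lemma keys_eq_empty_iff: "Poly_Mapping.keys p = {} \<longleftrightarrow> p = 0"
  by transfer auto

lemma keys_add_nat: "Poly_Mapping.keys (\<mu> + \<nu>) = Poly_Mapping.keys \<mu> \<union> Poly_Mapping.keys (\<nu> :: 'a \<Rightarrow>\<^sub>0 nat)"
  by (auto simp: in_keys_iff lookup_add)

text \<open>Monomials with different supports are compared over a common index set; the extra
  factors have exponent 0.\<close>

lemma monom_val_superset:
  assumes "finite A" "Poly_Mapping.keys \<mu> \<subseteq> A"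
  shows "monom_val v \<mu> = (\<Prod>j\<in>A. v j ^ Poly_Mapping.lookup \<mu> j)"
  unfolding monom_val_def using assms
  by (intro prod.mono_neutral_left) (auto simp: in_keys_iff)

lemma monom_val_add: "monom_val v (\<mu> + \<nu>) = monom_val v \<mu> * monom_val v \<nu>"
proof -
  let ?A = "Poly_Mapping.keys \<mu> \<union> Poly_Mapping.keys \<nu>"
  show ?thesis
    by (subst (1 2 3) monom_val_superset[of ?A])
       (auto simp: keys_add_nat lookup_add power_add prod.distrib)
qed

lemma monom_val_0 [simp]: "monom_val v 0 = 1"
  by (simp add: monom_val_def)

lemma monom_val_single [simp]: "monom_val v (Poly_Mapping.single j n) = v j ^ n"
  by (cases "n = 0") (simp_all add: monom_val_def)

lemma total_degree_superset:
  assumes "finite A" "Poly_Mapping.keys \<mu> \<subseteq> A"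
  shows "total_degree \<mu> = (\<Sum>j\<in>A. Poly_Mapping.lookup \<mu> j)"
  unfolding total_degree_def using assms
  by (intro sum.mono_neutral_left) (auto simp: in_keys_iff)

lemma total_degree_add: "total_degree (\<mu> + \<nu>) = total_degree \<mu> + total_degree \<nu>"
proof -
  let ?A = "Poly_Mapping.keys \<mu> \<union> Poly_Mapping.keys \<nu>"
  show ?thesis
    by (subst (1 2 3) total_degree_superset[of ?A])
       (auto simp: keys_add_nat lookup_add sum.distrib)
qed

lemma total_degree_0 [simp]: "total_degree 0 = 0"
  by (simp add: total_degree_def)

lemma total_degree_single [simp]: "total_degree (Poly_Mapping.single j n) = n"
  by (cases "n = 0") (simp_all add: total_degree_def)

lemma total_degree_eq_0_iff [simp]: "total_degree \<mu> = 0 \<longleftrightarrow> \<mu> = 0"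
  unfolding total_degree_def by (auto simp: in_keys_iff intro!: poly_mapping_eqI)

lemma monom_val_scale: "monom_val (\<lambda>j. c * v j) \<mu> = c ^ total_degree \<mu> * monom_val v \<mu>"
  by (simp add: monom_val_def total_degree_def power_mult_distrib prod.distrib power_sum)

lemma eval_poly_superset:
  assumes "finite A" "Poly_Mapping.keys p \<subseteq> A"
  shows "eval_poly p v = (\<Sum>\<mu>\<in>A. Poly_Mapping.lookup p \<mu> * monom_val v \<mu>)"
  unfolding eval_poly_def monom_val_def using assms
  by (intro sum.mono_neutral_left) (auto simp: in_keys_iff)

lemma eval_poly_altdef:
  "eval_poly p v = (\<Sum>\<mu>\<in>Poly_Mapping.keys p. Poly_Mapping.lookup p \<mu> * monom_val v \<mu>)"
  by (simp add: eval_poly_superset)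

lemma eval_poly_0 [simp]: "eval_poly 0 v = 0"
  by (simp add: eval_poly_def)

lemma eval_poly_add [simp]: "eval_poly (p + q) v = eval_poly p v + eval_poly q v"
proof -
  let ?A = "Poly_Mapping.keys p \<union> Poly_Mapping.keys q"
  show ?thesis
    using keys_add[of p q]
    by (subst (1 2 3) eval_poly_superset[of ?A])
       (auto simp: lookup_add sum.distrib algebra_simps)
qed

lemma eval_poly_minus [simp]: "eval_poly (- p) v = - eval_poly p v"
  using eval_poly_add[of p "- p" v] by (simp add: eq_neg_iff_add_eq_0 add.commute)

lemma eval_poly_diff [simp]: "eval_poly (p - q) v = eval_poly p v - eval_poly q v"
  using eval_poly_add[of p "- q" v] by simp

lemma eval_poly_sum [simp]: "eval_poly (sum f A) v = (\<Sum>x\<in>A. eval_poly (f x) v)"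
  by (induction A rule: infinite_finite_induct) auto

lemma eval_poly_single [simp]: "eval_poly (Poly_Mapping.single \<mu> c) v = c * monom_val v \<mu>"
  by (cases "c = 0") (simp_all add: eval_poly_altdef)

lemma eval_poly_1 [simp]: "eval_poly 1 v = 1"
  using eval_poly_single[of 0 1 v] by (simp del: eval_poly_single)

lemma eval_poly_pvar [simp]: "eval_poly (pvar j) v = v j"
  by (simp add: pvar_def)

lemma eval_poly_mult [simp]: "eval_poly (p * q) v = eval_poly p v * eval_poly q v"
proof -
  let ?l = Poly_Mapping.lookup and ?k = Poly_Mapping.keys
  have "p * q = (\<Sum>\<mu>\<in>?k p. Poly_Mapping.single \<mu> (?l p \<mu>)) * (\<Sum>\<nu>\<in>?k q. Poly_Mapping.single \<nu> (?l q \<nu>))"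
    by (intro arg_cong2[of _ _ _ _ "(*)"] poly_mapping_eq_sum_single)
  also have "\<dots> = (\<Sum>\<mu>\<in>?k p. \<Sum>\<nu>\<in>?k q. Poly_Mapping.single (\<mu> + \<nu>) (?l p \<mu> * ?l q \<nu>))"
    by (simp add: sum_product mult_single)
  also have "eval_poly \<dots> v = (\<Sum>\<mu>\<in>?k p. \<Sum>\<nu>\<in>?k q. (?l p \<mu> * monom_val v \<mu>) * (?l q \<nu> * monom_val v \<nu>))"
    by (simp add: monom_val_add mult_ac)
  also have "\<dots> = eval_poly p v * eval_poly q v"
    by (simp add: eval_poly_altdef sum_product)
  finally show ?thesis .
qed

lemma eval_poly_power [simp]: "eval_poly (p ^ n) v = eval_poly p v ^ n"
  by (induction n) auto

lemma eval_poly_prod [simp]: "eval_poly (prod f A) v = (\<Prod>x\<in>A. eval_poly (f x) v)"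
  by (induction A rule: infinite_finite_induct) auto

text \<open>A nonzero polynomial over an infinite field has a nonzero value, by induction on the
  variables. The last hypothesis says that no two terms merge when only the variables in
  \<open>A\<close> are looked at.\<close>

lemma monomial_sum_nonzero_point:
  fixes c :: "(nat \<Rightarrow>\<^sub>0 nat) \<Rightarrow> 'k::field"
  assumes inf: "infinite (UNIV :: 'k set)"
    and "finite A" "finite M" "M \<noteq> {}" "\<And>\<mu>. \<mu> \<in> M \<Longrightarrow> c \<mu> \<noteq> 0"
    and "\<And>\<mu> \<nu>. \<mu> \<in> M \<Longrightarrow> \<nu> \<in> M \<Longrightarrow>
      (\<And>j. j \<in> A \<Longrightarrow> Poly_Mapping.lookup \<mu> j = Poly_Mapping.lookup \<nu> j) \<Longrightarrow> \<mu> = \<nu>"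
  shows "\<exists>v. (\<Sum>\<mu>\<in>M. c \<mu> * (\<Prod>j\<in>A. v j ^ Poly_Mapping.lookup \<mu> j)) \<noteq> 0"
  using assms(2-)
proof (induction A arbitrary: M rule: finite_induct)
  case empty
  then obtain \<mu> where "M = {\<mu>}" by blast
  with empty show ?case by simp
next
  case (insert x A)
  obtain \<mu>0 where \<mu>0: "\<mu>0 \<in> M" using insert.prems by blast
  \<comment> \<open>The terms in \<open>N\<close> make up the coefficient of the \<open>k\<close>-th
    power of variable \<open>x\<close>; \<open>N\<close> is nonempty because \<open>k\<close>
    occurs.\<close>
  define k where "k = Poly_Mapping.lookup \<mu>0 x"
  define N where "N = {\<mu>\<in>M. Poly_Mapping.lookup \<mu> x = k}"
  have "\<exists>v. (\<Sum>\<mu>\<in>N. c \<mu> * (\<Prod>j\<in>A. v j ^ Poly_Mapping.lookup \<mu> j)) \<noteq> 0"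
  proof (rule insert.IH)
    show "finite N" "N \<noteq> {}" using insert.prems \<mu>0 by (auto simp: N_def k_def)
    show "c \<mu> \<noteq> 0" if "\<mu> \<in> N" for \<mu> using that insert.prems by (auto simp: N_def)
    show "\<mu> = \<nu>" if mn: "\<mu> \<in> N" "\<nu> \<in> N"
      "\<And>j. j \<in> A \<Longrightarrow> Poly_Mapping.lookup \<mu> j = Poly_Mapping.lookup \<nu> j" for \<mu> \<nu>
    proof (rule insert.prems(4))
      show "Poly_Mapping.lookup \<mu> j = Poly_Mapping.lookup \<nu> j" if "j \<in> insert x A" for j
        using that mn(1,2) mn(3)[of j] by (cases "j = x") (simp_all add: N_def)
    qed (use mn(1,2) in \<open>simp_all add: N_def\<close>)
  qed
  then obtain v where v: "(\<Sum>\<mu>\<in>N. c \<mu> * (\<Prod>j\<in>A. v j ^ Poly_Mapping.lookup \<mu> j)) \<noteq> 0" ..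
  define a where "a \<mu> = c \<mu> * (\<Prod>j\<in>A. v j ^ Poly_Mapping.lookup \<mu> j)" for \<mu>
  \<comment> \<open>What remains as a polynomial in variable \<open>x\<close> once the others take
    the values \<open>v\<close>; its \<open>k\<close>-th coefficient is the nonzero value just
    found.\<close>
  define q where "q = (\<Sum>\<mu>\<in>M. monom (a \<mu>) (Poly_Mapping.lookup \<mu> x))"
  have "coeff q k = (\<Sum>\<mu>\<in>M. if Poly_Mapping.lookup \<mu> x = k then a \<mu> else 0)"
    by (auto simp: q_def coeff_sum intro!: sum.cong)
  also have "\<dots> = sum a N"
    unfolding N_def using insert.prems by (intro sum.inter_filter[symmetric]) auto
  finally have "q \<noteq> 0" using v by (auto simp: a_def)
  then obtain z where z: "poly q z \<noteq> 0"
    using inf poly_roots_finite[of q] by fastforce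
  have "poly q z = (\<Sum>\<mu>\<in>M. c \<mu> * (\<Prod>j\<in>insert x A. (v(x := z)) j ^ Poly_Mapping.lookup \<mu> j))"
  proof -
    have "(\<Prod>j\<in>A. (v(x := z)) j ^ Poly_Mapping.lookup \<mu> j) = (\<Prod>j\<in>A. v j ^ Poly_Mapping.lookup \<mu> j)" for \<mu>
      using insert.hyps by (intro prod.cong) auto
    thus ?thesis using insert.hyps
      by (simp add: q_def poly_sum poly_monom a_def mult_ac)
  qed
  with z show ?case by metis
qed

text \<open>The values outside \<open>A\<close> do not matter and are set to 0, so that the vector
  can represent a point of a coordinate subspace.\<close>

lemma eval_poly_nonzero_point:
  fixes p :: "'k::field poly_ring"
  assumes inf: "infinite (UNIV :: 'k set)" and "p \<noteq> 0"
    and A: "finite A" "\<And>\<mu>. \<mu> \<in> Poly_Mapping.keys p \<Longrightarrow> Poly_Mapping.keys \<mu> \<subseteq> A"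
  obtains v where "eval_poly p v \<noteq> 0" "\<And>j. j \<notin> A \<Longrightarrow> v j = 0"
proof -
  have "\<exists>v. (\<Sum>\<mu>\<in>Poly_Mapping.keys p. Poly_Mapping.lookup p \<mu> * (\<Prod>j\<in>A. v j ^ Poly_Mapping.lookup \<mu> j)) \<noteq> 0"
  proof (rule monomial_sum_nonzero_point[OF inf])
    show "Poly_Mapping.keys p \<noteq> {}" using \<open>p \<noteq> 0\<close> by (simp add: keys_eq_empty_iff)
    show "\<mu> = \<nu>" if mn: "\<mu> \<in> Poly_Mapping.keys p" "\<nu> \<in> Poly_Mapping.keys p"
      "\<And>j. j \<in> A \<Longrightarrow> Poly_Mapping.lookup \<mu> j = Poly_Mapping.lookup \<nu> j" for \<mu> \<nu>
    proof (rule poly_mapping_eqI)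
      fix j show "Poly_Mapping.lookup \<mu> j = Poly_Mapping.lookup \<nu> j"
      proof (cases "j \<in> A")
        case False
        hence "j \<notin> Poly_Mapping.keys \<mu>" "j \<notin> Poly_Mapping.keys \<nu>" using mn A(2) by blast+
        thus ?thesis by (simp add: in_keys_iff)
      qed (rule mn(3))
    qed
  qed (use A in \<open>auto simp: in_keys_iff\<close>)
  then obtain v where v: "(\<Sum>\<mu>\<in>Poly_Mapping.keys p. Poly_Mapping.lookup p \<mu> * (\<Prod>j\<in>A. v j ^ Poly_Mapping.lookup \<mu> j)) \<noteq> 0" ..
  define w where "w j = (if j \<in> A then v j else 0)" for j
  have "eval_poly p w = (\<Sum>\<mu>\<in>Poly_Mapping.keys p. Poly_Mapping.lookup p \<mu> * (\<Prod>j\<in>A. v j ^ Poly_Mapping.lookup \<mu> j))"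
    unfolding eval_poly_altdef using A
    by (intro sum.cong) (auto simp: monom_val_superset[of A] w_def)
  with v that[of w] show ?thesis by (auto simp: w_def)
qed

text \<open>On a line a form becomes a univariate polynomial, where a nonzero one has finitely many
  roots.\<close>

lemma eval_poly_on_line:
  fixes p :: "'k::field poly_ring"
  obtains f where "\<And>z. poly f z = eval_poly p (\<lambda>j. a j + z * b j)"
proof
  fix z
  show "poly (\<Sum>\<mu>\<in>Poly_Mapping.keys p. smult (Poly_Mapping.lookup p \<mu>)
      (\<Prod>j\<in>Poly_Mapping.keys \<mu>. [:a j, b j:] ^ Poly_Mapping.lookup \<mu> j)) z =
      eval_poly p (\<lambda>j. a j + z * b j)"
    by (simp add: eval_poly_def poly_sum poly_prod)
qed

section \<open>Forms\<close>

lemma forms_altdef: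
  "p \<in> forms d m \<longleftrightarrow> (\<forall>\<mu>\<in>Poly_Mapping.keys p. Poly_Mapping.keys \<mu> \<subseteq> {..d} \<and> total_degree \<mu> = m)"
  by (simp add: forms_def total_degree_def)

lemma zero_in_forms [simp]: "0 \<in> forms d m"
  by (simp add: forms_altdef)

lemma one_in_forms [simp]: "1 \<in> forms d 0"
  by (simp add: forms_altdef)

lemma forms_add: "p \<in> forms d m \<Longrightarrow> q \<in> forms d m \<Longrightarrow> p + q \<in> forms d m"
  using keys_add[of p q] by (fastforce simp: forms_altdef)

lemma forms_minus: "p \<in> forms d m \<Longrightarrow> - p \<in> forms d m"
  by (auto simp: forms_altdef in_keys_iff)

lemma forms_diff: "p \<in> forms d m \<Longrightarrow> q \<in> forms d m \<Longrightarrow> p - q \<in> forms d m"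
  using forms_add[of p d m "- q"] forms_minus[of q d m] by simp

lemma forms_sum: "(\<And>x. x \<in> A \<Longrightarrow> f x \<in> forms d m) \<Longrightarrow> sum f A \<in> forms d m"
  by (induction A rule: infinite_finite_induct) (auto intro: forms_add)

lemma forms_mult: "p \<in> forms d m \<Longrightarrow> q \<in> forms d n \<Longrightarrow> p * q \<in> forms d (m + n)"
  using keys_mult[of p q] by (fastforce simp: forms_altdef keys_add_nat total_degree_add)

lemma forms_power: "p \<in> forms d m \<Longrightarrow> p ^ n \<in> forms d (n * m)"
  by (induction n) (auto intro: forms_mult)

lemma forms_prod: "(\<And>x. x \<in> A \<Longrightarrow> f x \<in> forms d (m x)) \<Longrightarrow> prod f A \<in> forms d (sum m A)"
  by (induction A rule: infinite_finite_induct) (auto intro: forms_mult)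

lemma forms_pvar: "j \<le> d \<Longrightarrow> pvar j \<in> forms d 1"
  by (simp add: forms_altdef pvar_def)

lemma forms_single:
  "Poly_Mapping.keys \<mu> \<subseteq> {..d} \<Longrightarrow> total_degree \<mu> = m \<Longrightarrow> Poly_Mapping.single \<mu> c \<in> forms d m"
  by (simp add: forms_altdef)

lemma eval_poly_scale:
  assumes "p \<in> forms d m"
  shows "eval_poly p (\<lambda>j. c * v j) = c ^ m * eval_poly p v"
  unfolding eval_poly_altdef sum_distrib_left using assms
  by (intro sum.cong) (auto simp: forms_altdef monom_val_scale)

text \<open>Division by \<open>x_j\<close> with remainder \<open>A\<close>. The separate clause for
  \<open>m = 0\<close> repairs the truncated degree \<open>m - 1\<close>; the clauses on keys record
  which monomials of \<open>h\<close> the parts come from, which later ties valuations to the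
  support.\<close>

lemma forms_split_pvar:
  assumes h: "h \<in> forms d m"
  obtains A Q where "h = A + pvar j * Q" "A \<in> forms d m" "Q \<in> forms d (m - 1)" "m = 0 \<Longrightarrow> Q = 0"
    "Poly_Mapping.keys A = {\<mu>\<in>Poly_Mapping.keys h. Poly_Mapping.lookup \<mu> j = 0}"
    "\<And>\<nu>. \<nu> \<in> Poly_Mapping.keys Q \<Longrightarrow> \<nu> + Poly_Mapping.single j 1 \<in> Poly_Mapping.keys h"
proof -
  let ?l = Poly_Mapping.lookup and ?k = Poly_Mapping.keys and ?s = Poly_Mapping.single
  define e where "e = ?s j (1::nat)"
  define M where "M = {\<mu>\<in>?k h. ?l \<mu> j = 0}"
  define N where "N = {\<mu>\<in>?k h. ?l \<mu> j \<noteq> 0}"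
  define A where "A = (\<Sum>\<mu>\<in>M. ?s \<mu> (?l h \<mu>))"
  define Q where "Q = (\<Sum>\<mu>\<in>N. ?s (\<mu> - e) (?l h \<mu>))"
  have fin: "finite M" "finite N" by (auto simp: M_def N_def)
  have e: "\<mu> - e + e = \<mu>" if "\<mu> \<in> N" for \<mu>
    using that by (intro poly_mapping_eqI) (auto simp add: N_def e_def lookup_add lookup_minus lookup_single when_def)
  have "?k h = M \<union> N" by (auto simp: M_def N_def)
  hence "h = (\<Sum>\<mu>\<in>M \<union> N. ?s \<mu> (?l h \<mu>))"
    using poly_mapping_eq_sum_single[of h] by simp
  also have "\<dots> = A + (\<Sum>\<mu>\<in>N. ?s \<mu> (?l h \<mu>))"
    unfolding A_def using fin by (intro sum.union_disjoint) (auto simp: M_def N_def)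
  also have "(\<Sum>\<mu>\<in>N. ?s \<mu> (?l h \<mu>)) = pvar j * Q"
    unfolding Q_def sum_distrib_left pvar_def e_def[symmetric] mult_single
    using e by (intro sum.cong) (simp_all add: add.commute)
  finally have eq: "h = A + pvar j * Q" .
  have lA: "?l A \<nu> = (if \<nu> \<in> M then ?l h \<nu> else 0)" for \<nu>
    using fin by (simp add: A_def lookup_sum lookup_single when_def)
  have kA: "?k A = M" unfolding set_eq_iff in_keys_iff[of _ A] lA by (simp add: M_def in_keys_iff)
  have kQ: "\<nu> + e \<in> ?k h" if "\<nu> \<in> ?k Q" for \<nu>
  proof -
    have "\<nu> \<in> (\<Union>\<mu>\<in>N. ?k (?s (\<mu> - e) (?l h \<mu>)))" using that keys_sum unfolding Q_def by fast
    then obtain \<mu> where "\<mu> \<in> N" "\<nu> = \<mu> - e" by (auto split: if_splits)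
    thus ?thesis using e[of \<mu>] by (auto simp: N_def)
  qed
  \<comment> \<open>Stated with \<open>Suc\<close> instead of \<open>m - 1\<close>, so that for
    \<open>m = 0\<close> it rules out all exponents of \<open>Q\<close>.\<close>
  have tQ: "?k \<nu> \<subseteq> {..d} \<and> Suc (total_degree \<nu>) = m" if "\<nu> \<in> ?k Q" for \<nu>
  proof -
    have "?k (\<nu> + e) \<subseteq> {..d} \<and> total_degree (\<nu> + e) = m"
      using h kQ[OF that] unfolding forms_altdef by blast
    thus ?thesis by (simp add: keys_add_nat total_degree_add e_def)
  qed
  show ?thesis
  proof (rule that[OF eq])
    show "A \<in> forms d m" using h unfolding forms_altdef kA by (simp add: M_def)
    show "Q \<in> forms d (m - 1)" unfolding forms_altdef
    proof
      fix \<nu> assume "\<nu> \<in> ?k Q"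
      from tQ[OF this] show "?k \<nu> \<subseteq> {..d} \<and> total_degree \<nu> = m - 1" by auto
    qed
    show "Q = 0" if "m = 0"
    proof -
      have "\<nu> \<notin> ?k Q" for \<nu> using tQ[of \<nu>] that by auto
      thus ?thesis unfolding keys_eq_empty_iff[symmetric] by blast
    qed
    show "?k A = {\<mu>\<in>?k h. ?l \<mu> j = 0}" using kA by (simp add: M_def)
    show "\<nu> + ?s j 1 \<in> ?k h" if "\<nu> \<in> ?k Q" for \<nu> using kQ[OF that] by (simp add: e_def)
  qed
qed

section \<open>Irreducible closed sets and the dimension of projective space\<close>

definition proj_pt :: "(nat \<Rightarrow> 'k::field) \<Rightarrow> 'k proj_point" where
  "proj_pt v = {(\<lambda>j. c * v j) | c. c \<noteq> 0}"

lemma proj_pt_self: "v \<in> proj_pt v"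
  unfolding proj_pt_def by (rule CollectI, rule exI[of _ 1]) simp

lemma proj_spaceI: "v \<noteq> (\<lambda>_. 0) \<Longrightarrow> (\<And>j. j > d \<Longrightarrow> v j = 0) \<Longrightarrow> proj_pt v \<in> proj_space d"
  by (auto simp: proj_space_def proj_pt_def)

lemma proj_spaceE:
  assumes "P \<in> proj_space d" "v \<in> P"
  shows "P = proj_pt v" "v \<noteq> (\<lambda>_. 0)" "\<And>j. j > d \<Longrightarrow> v j = 0"
proof -
  obtain w where w: "P = proj_pt w" "w \<noteq> (\<lambda>_. 0)" "\<forall>j>d. w j = 0"
    using assms(1) by (auto simp: proj_space_def proj_pt_def)
  obtain c where c: "c \<noteq> 0" "v = (\<lambda>j. c * w j)" using assms(2) w(1) by (auto simp: proj_pt_def)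
  have "\<exists>b. b \<noteq> 0 \<and> (\<lambda>j. a * w j) = (\<lambda>j. b * v j)" if "a \<noteq> 0" for a
    using that c by (intro exI[of _ "a / c"]) auto
  moreover have "\<exists>b. b \<noteq> 0 \<and> (\<lambda>j. a * v j) = (\<lambda>j. b * w j)" if "a \<noteq> 0" for a
    using that c by (intro exI[of _ "a * c"]) (auto simp: mult.assoc)
  ultimately show "P = proj_pt v" unfolding w(1) unfolding proj_pt_def by blast
  show "v \<noteq> (\<lambda>_. 0)" using w(2) c by (auto simp: fun_eq_iff)
  show "v j = 0" if "j > d" for j using that w(3) c by auto
qed

lemma proj_space_nonempty: "P \<in> proj_space d \<Longrightarrow> \<exists>v. v \<in> P"
  using proj_pt_self by (fastforce simp: proj_space_def proj_pt_def)

lemma vanishes_on_subset: "vanishes_on F Z \<Longrightarrow> Y \<subseteq> Z \<Longrightarrow> vanishes_on F Y"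
  by (auto simp: vanishes_on_def)

lemma vanishes_on_Un: "vanishes_on F (A \<union> B) \<longleftrightarrow> vanishes_on F A \<and> vanishes_on F B"
  by (auto simp: vanishes_on_def)

lemma vanishes_on_0 [simp]: "vanishes_on 0 Z"
  by (simp add: vanishes_on_def)

lemma vanishes_on_add: "vanishes_on F Z \<Longrightarrow> vanishes_on G Z \<Longrightarrow> vanishes_on (F + G) Z"
  by (simp add: vanishes_on_def)

lemma vanishes_on_diff: "vanishes_on F Z \<Longrightarrow> vanishes_on G Z \<Longrightarrow> vanishes_on (F - G) Z"
  by (simp add: vanishes_on_def)

lemma vanishes_on_mult: "vanishes_on F Z \<or> vanishes_on G Z \<Longrightarrow> vanishes_on (F * G) Z"
  by (auto simp: vanishes_on_def)

text \<open>By homogeneity the coordinate vectors of a point agree on whether a form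
  vanishes.\<close>

lemma vanishes_on_point_iff:
  assumes "F \<in> forms d m" "P \<in> proj_space d" "v \<in> P"
  shows "vanishes_on F {P} \<longleftrightarrow> eval_poly F v = 0"
  using proj_spaceE[OF assms(2,3)] assms(3) eval_poly_scale[OF assms(1)]
  by (auto simp: vanishes_on_def proj_pt_def)

section \<open>Irreducible closed sets and prime ideals of forms\<close>

lemma zariski_closed_subset: "zariski_closed d Z \<Longrightarrow> Z \<subseteq> proj_space d"
  by (auto simp: zariski_closed_def)

lemma subvariety_subset: "subvariety d Z \<Longrightarrow> Z \<subseteq> proj_space d"
  by (simp add: subvariety_def zariski_closed_subset)

lemma zariski_closed_Int_vanishing:
  assumes "zariski_closed d Z" "F \<in> forms d m"
  shows "zariski_closed d {P\<in>Z. vanishes_on F {P}}"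
proof -
  obtain S where S: "S \<subseteq> (\<Union>m. forms d m)" "Z = {P \<in> proj_space d. \<forall>F\<in>S. vanishes_on F {P}}"
    using assms(1) by (auto simp: zariski_closed_def)
  show ?thesis unfolding zariski_closed_def
    using S assms(2) by (intro exI[of _ "insert F S"]) auto
qed

text \<open>Some defining form of \<open>Z\<close> is nonzero at a point of \<open>Y\<close> outside
  \<open>Z\<close>; this turns strict inclusions into forms.\<close>

lemma zariski_closed_separate:
  assumes "zariski_closed d Z" "Y \<subseteq> proj_space d" "\<not> Y \<subseteq> Z"
  obtains F m where "F \<in> forms d m" "vanishes_on F Z" "\<not> vanishes_on F Y"
proof -
  obtain S where S: "S \<subseteq> (\<Union>m. forms d m)" "Z = {P \<in> proj_space d. \<forall>F\<in>S. vanishes_on F {P}}"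
    using assms(1) by (auto simp: zariski_closed_def)
  obtain P where P: "P \<in> Y" "P \<notin> Z" using assms by blast
  then obtain F where F: "F \<in> S" "\<not> vanishes_on F {P}" using S assms by blast
  have "vanishes_on F Z" using S(2) F(1) by (auto simp: vanishes_on_def)
  moreover have "\<not> vanishes_on F Y" using vanishes_on_subset F P by blast
  ultimately show ?thesis using that F S by blast
qed

text \<open>\<open>Z\<close> is the union of the zero loci of \<open>F\<close> and of
  \<open>G\<close> inside it; both are closed, so irreducibility makes one of them all of
  \<open>Z\<close>.\<close>

lemma subvariety_vanishes_mult:
  assumes Z: "subvariety d Z" and F: "F \<in> forms d m" and G: "G \<in> forms d n"
    and FG: "vanishes_on (F * G) Z"
  shows "vanishes_on F Z \<or> vanishes_on G Z"
proof -
  let ?A = "{P\<in>Z. vanishes_on F {P}}" and ?B = "{P\<in>Z. vanishes_on G {P}}"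
  have "Z \<subseteq> ?A \<union> ?B"
  proof
    fix P assume P: "P \<in> Z"
    hence P': "P \<in> proj_space d" using subvariety_subset[OF Z] by blast
    obtain v where v: "v \<in> P" using proj_space_nonempty[OF P'] by blast
    have "eval_poly F v * eval_poly G v = 0" using FG P v by (fastforce simp: vanishes_on_def)
    thus "P \<in> ?A \<union> ?B"
      using P vanishes_on_point_iff[OF F P' v] vanishes_on_point_iff[OF G P' v] by auto
  qed
  hence eq: "Z = ?A \<union> ?B" by blast
  have cl: "zariski_closed d Z" using Z by (simp add: subvariety_def)
  from eq have "Z = ?A \<or> Z = ?B"
    using Z zariski_closed_Int_vanishing[OF cl F] zariski_closed_Int_vanishing[OF cl G]
    unfolding subvariety_def by blast
  thus ?thesis unfolding vanishes_on_def by blast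
qed

text \<open>For \<open>n = 0\<close> the hypothesis is contradictory, as \<open>Z\<close> has a
  point; this instance shows later that 1 does not vanish on \<open>Z\<close>.\<close>

lemma subvariety_vanishes_power:
  assumes Z: "subvariety d Z" and F: "F \<in> forms d m" and "vanishes_on (F ^ n) Z"
  shows "vanishes_on F Z"
  using assms(3)
proof (induction n)
  case 0
  obtain P where "P \<in> Z" using Z by (auto simp: subvariety_def)
  moreover obtain v where "v \<in> P" using proj_space_nonempty \<open>P \<in> Z\<close> subvariety_subset[OF Z] by blast
  ultimately show ?case using 0 by (auto simp: vanishes_on_def)
next
  case (Suc n)
  thus ?case using subvariety_vanishes_mult[OF Z F forms_power[OF F, of n]] by auto
qed

text \<open>If neither closed part is everything, each has a form that vanishes on it but not on
  \<open>Z\<close>, and their product contradicts primality.\<close>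

lemma subvarietyI:
  assumes "zariski_closed d Z" "Z \<noteq> {}"
    and prime: "\<And>F G m n. F \<in> forms d m \<Longrightarrow> G \<in> forms d n \<Longrightarrow> vanishes_on (F * G) Z \<Longrightarrow>
      vanishes_on F Z \<or> vanishes_on G Z"
  shows "subvariety d Z"
  unfolding subvariety_def
proof (intro conjI allI impI)
  fix A B assume AB: "zariski_closed d A \<and> zariski_closed d B \<and> Z = A \<union> B"
  show "Z = A \<or> Z = B"
  proof (rule ccontr)
    assume "\<not> (Z = A \<or> Z = B)"
    hence "\<not> Z \<subseteq> A" "\<not> Z \<subseteq> B" using AB by blast+
    then obtain F m G n where *: "F \<in> forms d m" "vanishes_on F A" "\<not> vanishes_on F Z"
        "G \<in> forms d n" "vanishes_on G B" "\<not> vanishes_on G Z"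
      using zariski_closed_separate AB zariski_closed_subset[OF assms(1)] by metis
    have "vanishes_on (F * G) Z" using * AB vanishes_on_mult by (metis vanishes_on_Un)
    with prime * show False by blast
  qed
qed (use assms in auto)

text \<open>If \<open>F\<^sub>0\<close> does not vanish on \<open>C\<^sub>0\<close> and each \<open>F\<^sub>i\<^sub>+\<^sub>1\<close> vanishes on \<open>C\<^sub>i\<close> but not on \<open>C\<^sub>i\<^sub>+\<^sub>1\<close>, then
  \<open>F\<^sub>0, \<dots>, F\<^sub>n\<close> satisfy no homogeneous relation on \<open>C\<^sub>n\<close>: divide the relation by the
  highest possible power of \<open>F\<^sub>n\<close> and restrict to \<open>C\<^sub>n\<^sub>-\<^sub>1\<close>, where only the terms without \<open>F\<^sub>n\<close>
  survive.\<close>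

lemma chain_forms_independent:
  fixes F :: "nat \<Rightarrow> 'k::field poly_ring" and c :: "'i \<Rightarrow> 'k" and a :: "'i \<Rightarrow> nat \<Rightarrow> nat"
  assumes sub: "\<And>i. i \<le> n \<Longrightarrow> subvariety d (C i)"
    and inc: "\<And>i. i < n \<Longrightarrow> C i \<subseteq> C (Suc i)"
    and F: "\<And>i. i \<le> n \<Longrightarrow> F i \<in> forms d D"
    and nv: "\<And>i. i \<le> n \<Longrightarrow> \<not> vanishes_on (F i) (C i)"
    and v: "\<And>i. i < n \<Longrightarrow> vanishes_on (F (Suc i)) (C i)"
    and I: "finite I" "I \<noteq> {}" "\<And>i. i \<in> I \<Longrightarrow> c i \<noteq> 0"
    and deg: "\<And>i. i \<in> I \<Longrightarrow> (\<Sum>j\<le>n. a i j) = k"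
    and inj: "\<And>i i'. i \<in> I \<Longrightarrow> i' \<in> I \<Longrightarrow> (\<And>j. j \<le> n \<Longrightarrow> a i j = a i' j) \<Longrightarrow> i = i'"
  shows "\<not> vanishes_on (\<Sum>i\<in>I. mpoly_scale (c i) (\<Prod>j\<le>n. F j ^ a i j)) (C n)"
  using assms
proof (induction n arbitrary: I k)
  case 0
  \<comment> \<open>With a single form the degree condition forces its exponent to be
    \<open>k\<close>.\<close>
  have "i = i'" if "i \<in> I" "i' \<in> I" for i i'
    using that "0.prems"(9)[of i] "0.prems"(9)[of i'] by (intro "0.prems"(10)) auto
  then obtain i where i: "I = {i}" using \<open>I \<noteq> {}\<close> by blast
  have "\<not> vanishes_on (F 0 ^ a i 0) (C 0)"
    using subvariety_vanishes_power[OF "0.prems"(1) "0.prems"(3)] "0.prems"(4) by blast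
  thus ?case using "0.prems"(8)[of i] i by (auto simp: mpoly_scale_def vanishes_on_def)
next
  case (Suc n)
  note sub = Suc.prems(1) and F = Suc.prems(3)
  \<comment> \<open>The highest power of \<open>F (Suc n)\<close> that divides every term;
    \<open>G\<close> below is the quotient.\<close>
  define r where "r = Min ((\<lambda>i. a i (Suc n)) ` I)"
  have r_le: "r \<le> a i (Suc n)" if "i \<in> I" for i using that Suc.prems(6) by (simp add: r_def)
  have "r \<in> (\<lambda>i. a i (Suc n)) ` I" unfolding r_def using Suc.prems(6,7) by (intro Min_in) auto
  then obtain i0 where i0: "i0 \<in> I" "a i0 (Suc n) = r" by blast
  define J where "J = {i\<in>I. a i (Suc n) = r}"
  define G where "G = (\<Sum>i\<in>I. mpoly_scale (c i) ((\<Prod>j\<le>n. F j ^ a i j) * F (Suc n) ^ (a i (Suc n) - r)))"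
  have split: "(\<Sum>i\<in>I. mpoly_scale (c i) (\<Prod>j\<le>Suc n. F j ^ a i j)) = F (Suc n) ^ r * G"
    unfolding G_def sum_distrib_left
  proof (rule sum.cong)
    fix i assume "i \<in> I"
    have "F (Suc n) ^ a i (Suc n) = F (Suc n) ^ r * F (Suc n) ^ (a i (Suc n) - r)"
      using r_le[OF \<open>i \<in> I\<close>] by (simp flip: power_add)
    thus "mpoly_scale (c i) (\<Prod>j\<le>Suc n. F j ^ a i j) =
        F (Suc n) ^ r * mpoly_scale (c i) ((\<Prod>j\<le>n. F j ^ a i j) * F (Suc n) ^ (a i (Suc n) - r))"
      by (simp add: mpoly_scale_def mult_ac)
  qed auto
  \<comment> \<open>Primality is available for forms only, so \<open>G\<close> has to be
    homogeneous: each term has \<open>k - r\<close> factors of degree \<open>D\<close>.\<close>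
  have G: "G \<in> forms d ((k - r) * D)"
    unfolding G_def
  proof (rule forms_sum)
    fix i assume i: "i \<in> I"
    have "Poly_Mapping.single 0 (c i) \<in> forms d 0" by (auto intro: forms_single)
    moreover have "(\<Prod>j\<le>n. F j ^ a i j) \<in> forms d (\<Sum>j\<le>n. a i j * D)"
      using F by (intro forms_prod forms_power) auto
    moreover have "F (Suc n) ^ (a i (Suc n) - r) \<in> forms d ((a i (Suc n) - r) * D)"
      using F by (intro forms_power) auto
    ultimately have "mpoly_scale (c i) ((\<Prod>j\<le>n. F j ^ a i j) * F (Suc n) ^ (a i (Suc n) - r))
        \<in> forms d (0 + ((\<Sum>j\<le>n. a i j * D) + (a i (Suc n) - r) * D))"
      unfolding mpoly_scale_def by (intro forms_mult)
    also have "0 + ((\<Sum>j\<le>n. a i j * D) + (a i (Suc n) - r) * D) = (k - r) * D"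
    proof -
      have "(\<Sum>j\<le>n. a i j) + (a i (Suc n) - r) = k - r"
        using Suc.prems(9)[OF i] r_le[OF i] by simp
      thus ?thesis by (metis add_0 distrib_right sum_distrib_right)
    qed
    finally show "mpoly_scale (c i) ((\<Prod>j\<le>n. F j ^ a i j) * F (Suc n) ^ (a i (Suc n) - r))
        \<in> forms d ((k - r) * D)" .
  qed
  show ?case
  proof
    assume "vanishes_on (\<Sum>i\<in>I. mpoly_scale (c i) (\<Prod>j\<le>Suc n. F j ^ a i j)) (C (Suc n))"
    hence "vanishes_on (F (Suc n) ^ r * G) (C (Suc n))" by (simp only: split)
    hence "vanishes_on (F (Suc n) ^ r) (C (Suc n)) \<or> vanishes_on G (C (Suc n))"
      using subvariety_vanishes_mult[OF sub[of "Suc n"] forms_power[OF F[of "Suc n"]] G] by simp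
    moreover have "\<not> vanishes_on (F (Suc n) ^ r) (C (Suc n))"
      using subvariety_vanishes_power[OF sub[of "Suc n"] F[of "Suc n"]] Suc.prems(4)[of "Suc n"] by blast
    ultimately have "vanishes_on G (C (Suc n))" by blast
    hence Gn: "vanishes_on G (C n)" using vanishes_on_subset Suc.prems(2)[of n] by auto
    have "vanishes_on (\<Sum>i\<in>J. mpoly_scale (c i) (\<Prod>j\<le>n. F j ^ a i j)) (C n)"
      unfolding vanishes_on_def
    proof (intro ballI)
      fix P w assume P: "P \<in> C n" "w \<in> P"
      have F0: "eval_poly (F (Suc n)) w = 0"
        using Suc.prems(5)[of n] P by (auto simp: vanishes_on_def)
      have "0 = eval_poly G w" using Gn P by (auto simp: vanishes_on_def)
      \<comment> \<open>As \<open>F (Suc n)\<close> is 0 here, the convention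
        \<open>0 ^ 0 = 1\<close> keeps exactly the terms whose exponent is \<open>r\<close>.\<close>
      also have "\<dots> = (\<Sum>i\<in>I. if a i (Suc n) = r then c i * (\<Prod>j\<le>n. eval_poly (F j) w ^ a i j) else 0)"
        unfolding G_def eval_poly_sum
        using F0 r_le by (intro sum.cong) (auto simp: mpoly_scale_def power_0_left dest: le_antisym)
      also have "\<dots> = (\<Sum>i\<in>J. c i * (\<Prod>j\<le>n. eval_poly (F j) w ^ a i j))"
        unfolding J_def using Suc.prems(6) by (intro sum.inter_filter[symmetric]) auto
      finally show "eval_poly (\<Sum>i\<in>J. mpoly_scale (c i) (\<Prod>j\<le>n. F j ^ a i j)) w = 0"
        by (simp add: mpoly_scale_def)
    qed
    moreover have "\<not> vanishes_on (\<Sum>i\<in>J. mpoly_scale (c i) (\<Prod>j\<le>n. F j ^ a i j)) (C n)"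
    proof (rule Suc.IH[where k = "k - r"])
      show "finite J" "J \<noteq> {}" using Suc.prems(6) i0 by (auto simp: J_def)
      show "c i \<noteq> 0" if "i \<in> J" for i using that Suc.prems(8) by (auto simp: J_def)
      show "(\<Sum>j\<le>n. a i j) = k - r" if "i \<in> J" for i
        using that Suc.prems(9)[of i] by (auto simp: J_def)
      show "i = i'" if ii: "i \<in> J" "i' \<in> J" "\<And>j. j \<le> n \<Longrightarrow> a i j = a i' j" for i i'
      proof (rule Suc.prems(10))
        show "a i j = a i' j" if "j \<le> Suc n" for j
          using that ii(1,2) ii(3)[of j] by (cases "j = Suc n") (auto simp: J_def)
      qed (use ii(1,2) in \<open>auto simp: J_def\<close>)
    qed (use Suc.prems(1-5) in simp_all)
    ultimately show False by blast
  qed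
qed

text \<open>The degree determines the exponent of \<open>x_0\<close>, so only \<open>d\<close>
  exponents are free. That the power is \<open>d\<close>, not \<open>d + 1\<close>, is what the
  dimension bound needs.\<close>

lemma card_exponents_le:
  "finite {\<mu>. Poly_Mapping.keys \<mu> \<subseteq> {..d} \<and> total_degree \<mu> = m}" (is "finite ?E")
  "card {\<mu>. Poly_Mapping.keys \<mu> \<subseteq> {..d} \<and> total_degree \<mu> = m} \<le> (m + 1) ^ d"
proof -
  let ?f = "\<lambda>\<mu>. restrict (Poly_Mapping.lookup \<mu>) {1..d}"
  let ?T = "PiE {1..d} (\<lambda>_. {..m})"
  have deg: "(\<Sum>j\<le>d. Poly_Mapping.lookup \<mu> j) = m" if "\<mu> \<in> ?E" for \<mu> :: "nat \<Rightarrow>\<^sub>0 nat"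
    using that total_degree_superset[of "{..d}" \<mu>] by auto
  have le: "Poly_Mapping.lookup \<mu> j \<le> m" if "\<mu> \<in> ?E" "j \<le> d" for \<mu> :: "nat \<Rightarrow>\<^sub>0 nat" and j
    using deg[OF that(1)] member_le_sum[of j "{..d}" "Poly_Mapping.lookup \<mu>"] that by auto
  have sub: "?f ` ?E \<subseteq> ?T" using le by (auto simp: PiE_iff)
  have inj: "inj_on ?f ?E"
  proof (rule inj_onI)
    fix \<mu> \<nu> assume E: "\<mu> \<in> ?E" "\<nu> \<in> ?E" and eq: "?f \<mu> = ?f \<nu>"
    have eq1: "Poly_Mapping.lookup \<mu> j = Poly_Mapping.lookup \<nu> j" if "j \<in> {1..d}" for j
      using fun_cong[OF eq, of j] that by (simp add: restrict_def del: atLeastAtMost_iff)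
    have s: "{..d} = insert 0 {1..d}" by auto
    have "(\<Sum>j\<in>{1..d}. Poly_Mapping.lookup \<mu> j) = (\<Sum>j\<in>{1..d}. Poly_Mapping.lookup \<nu> j)"
      using eq1 by (intro sum.cong) auto
    hence eq0: "Poly_Mapping.lookup \<mu> 0 = Poly_Mapping.lookup \<nu> 0"
      using deg[OF E(1)] deg[OF E(2)] unfolding s by simp
    show "\<mu> = \<nu>"
    proof (rule poly_mapping_eqI)
      fix j
      consider "j = 0" | "j \<in> {1..d}" | "j > d" by force
      thus "Poly_Mapping.lookup \<mu> j = Poly_Mapping.lookup \<nu> j"
      proof cases
        case 3
        hence "j \<notin> Poly_Mapping.keys \<mu>" "j \<notin> Poly_Mapping.keys \<nu>" using E by auto
        thus ?thesis by (simp add: in_keys_iff)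
      qed (use eq0 eq1 in auto)
    qed
  qed
  have fin: "finite ?T" by (intro finite_PiE) auto
  show "finite ?E" using inj sub fin by (rule inj_on_finite)
  have "card ?E \<le> card ?T" using inj sub fin by (rule card_inj_on_le)
  also have "card ?T = (m + 1) ^ d" by (subst card_PiE) auto
  finally show "card ?E \<le> (m + 1) ^ d" .
qed

lemma forms_subset_span:
  "forms d m \<subseteq> mpoly_vs.span
    ((\<lambda>\<mu>. Poly_Mapping.single \<mu> 1) ` {\<mu>. Poly_Mapping.keys \<mu> \<subseteq> {..d} \<and> total_degree \<mu> = m})"
proof
  fix p :: "'k::field poly_ring" assume p: "p \<in> forms d m"
  let ?S = "mpoly_vs.span
    ((\<lambda>\<mu>. Poly_Mapping.single \<mu> (1::'k)) ` {\<mu>. Poly_Mapping.keys \<mu> \<subseteq> {..d} \<and> total_degree \<mu> = m})"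
  have "(\<Sum>\<mu>\<in>Poly_Mapping.keys p. mpoly_scale (Poly_Mapping.lookup p \<mu>) (Poly_Mapping.single \<mu> 1)) \<in> ?S"
    using p by (intro mpoly_vs.span_sum mpoly_vs.span_scale mpoly_vs.span_base) (auto simp: forms_altdef)
  thus "p \<in> ?S"
    using poly_mapping_eq_sum_single[of p] by (simp add: mpoly_scale_def mult_single)
qed

text \<open>Products of the \<open>n + 1\<close> forms of the previous lemma give about \<open>q\<^sup>n\<close> independent forms of degree
  proportional to \<open>q\<close>, while the space of all such forms has dimension \<open>O(q\<^sup>d)\<close>.\<close>

lemma subvariety_chain_length_le:
  fixes C :: "nat \<Rightarrow> 'k::field proj_point set"
  assumes sub: "\<And>i. i \<le> n \<Longrightarrow> subvariety d (C i)"
    and inc: "\<And>i. i < n \<Longrightarrow> C i \<subset> C (Suc i)"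
  shows "n \<le> d"
proof (rule ccontr)
  assume "\<not> n \<le> d"
  hence dn: "Suc d \<le> n" by simp
  have C0: "C 0 \<subseteq> C i" if "i \<le> n" for i
    using that
  proof (induction i)
    case (Suc i)
    thus ?case using inc[of i] by auto
  qed simp
  obtain P where P: "P \<in> C 0" using sub[of 0] by (auto simp: subvariety_def)
  hence P': "P \<in> proj_space d" using subvariety_subset sub by blast
  then obtain v where v: "v \<in> P" using proj_space_nonempty by blast
  obtain j0 where j0: "v j0 \<noteq> 0" using proj_spaceE(2)[OF P' v] by auto
  hence "j0 \<le> d" using proj_spaceE(3)[OF P' v] by (meson not_le)
  \<comment> \<open>A coordinate that is nonzero at a point of \<open>C 0\<close>, hence on no
    member of the chain identically zero; it serves to equalize degrees.\<close>
  define X where "X = (pvar j0 :: 'k poly_ring)"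
  have X: "X \<in> forms d 1" unfolding X_def using \<open>j0 \<le> d\<close> by (rule forms_pvar)
  have "\<not> vanishes_on X (C 0)" using P v j0 by (auto simp: vanishes_on_def X_def)
  hence Xnv: "\<not> vanishes_on X (C i)" if "i \<le> n" for i using C0[OF that] vanishes_on_subset by blast
  have "\<forall>i. \<exists>F m. i < n \<longrightarrow> F \<in> forms d m \<and> vanishes_on F (C i) \<and> \<not> vanishes_on F (C (Suc i))"
  proof
    fix i
    show "\<exists>F m. i < n \<longrightarrow> F \<in> forms d m \<and> vanishes_on F (C i) \<and> \<not> vanishes_on F (C (Suc i))"
    proof (cases "i < n")
      case True
      hence "zariski_closed d (C i)" "C (Suc i) \<subseteq> proj_space d" "\<not> C (Suc i) \<subseteq> C i"
        using sub[of i] subvariety_subset[OF sub[of "Suc i"]] inc[of i] by (auto simp: subvariety_def)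
      thus ?thesis using zariski_closed_separate by metis
    qed auto
  qed
  then obtain H e where H: "\<And>i. i < n \<Longrightarrow> H i \<in> forms d (e i)" "\<And>i. i < n \<Longrightarrow> vanishes_on (H i) (C i)"
      "\<And>i. i < n \<Longrightarrow> \<not> vanishes_on (H i) (C (Suc i))"
    by metis
  \<comment> \<open>Any common upper bound of the degrees \<open>e i\<close> would do.\<close>
  define D where "D = (\<Sum>i<n. e i)"
  have eD: "e i \<le> D" if "i < n" for i unfolding D_def using that by (intro member_le_sum) auto
  define F where "F i = (case i of 0 \<Rightarrow> X ^ D | Suc l \<Rightarrow> H l * X ^ (D - e l))" for i
  have F: "F i \<in> forms d D" if "i \<le> n" for i
  proof (cases i)
    case 0
    thus ?thesis using forms_power[OF X, of D] by (simp add: F_def)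
  next
    case (Suc l)
    have "H l * X ^ (D - e l) \<in> forms d (e l + (D - e l) * 1)"
      using that Suc by (intro forms_mult forms_power X H) auto
    thus ?thesis using Suc eD[of l] that by (simp add: F_def)
  qed
  have nv: "\<not> vanishes_on (F i) (C i)" if "i \<le> n" for i
  proof (cases i)
    case 0
    thus ?thesis using subvariety_vanishes_power[OF sub X, of 0] Xnv[of 0] by (auto simp: F_def)
  next
    case (Suc l)
    hence "\<not> vanishes_on (H l * X ^ (D - e l)) (C i)"
      using subvariety_vanishes_mult[OF sub H(1) forms_power[OF X], of i l] that H(3)[of l]
        subvariety_vanishes_power[OF sub X, of i] Xnv[of i] by auto
    thus ?thesis using Suc by (simp add: F_def)
  qed
  have v: "vanishes_on (F (Suc i)) (C i)" if "i < n" for i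
    using H(2)[OF that] by (auto simp: F_def intro: vanishes_on_mult)
  \<comment> \<open>Large enough that \<open>(n * D + 1) ^ d < q\<close>, which gives the strict
    inequality of the final count.\<close>
  define q where "q = (n * D + 1) ^ d + 1"
  define B where "B = PiE {1..n} (\<lambda>_. {..<q})"
  have finB: "finite B" unfolding B_def by (intro finite_PiE) auto
  have cardB: "card B = q ^ n" unfolding B_def by (subst card_PiE) auto
  \<comment> \<open>The exponents of \<open>F 1\<close>, ..., \<open>F n\<close> are chosen freely
    below \<open>q\<close>, and that of \<open>F 0\<close> fills the degree up to
    \<open>n * q\<close>; the subtraction does not truncate on \<open>B\<close>.\<close>
  define a where "a b j = (if j = 0 then n * q - (\<Sum>j=1..n. b j) else b j)" for b :: "nat \<Rightarrow> nat" and j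
  have deg: "(\<Sum>j\<le>n. a b j) = n * q" if "b \<in> B" for b
  proof -
    have "(\<Sum>j=1..n. b j) \<le> (\<Sum>j=1..n. q)"
      using that by (intro sum_mono less_imp_le) (auto simp: B_def PiE_iff)
    hence le: "(\<Sum>j=1..n. b j) \<le> n * q" by simp
    have "{..n} = insert 0 {1..n}" by auto
    hence "(\<Sum>j\<le>n. a b j) = a b 0 + (\<Sum>j=1..n. a b j)" by (simp only: sum.insert) simp
    also have "(\<Sum>j=1..n. a b j) = (\<Sum>j=1..n. b j)" by (intro sum.cong) (auto simp: a_def)
    finally show ?thesis using le unfolding a_def by simp
  qed
  have inj: "b = b'" if b: "b \<in> B" "b' \<in> B" "\<And>j. j \<le> n \<Longrightarrow> a b j = a b' j" for b b'
  proof (rule PiE_ext)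
    show "b j = b' j" if "j \<in> {1..n}" for j using b(3)[of j] that by (auto simp: a_def)
  qed (use b(1,2) in \<open>auto simp: B_def\<close>)
  define g where "g b = (\<Prod>j\<le>n. F j ^ a b j)" for b
  have indep: "\<not> vanishes_on (\<Sum>b\<in>I. mpoly_scale (c b) (g b)) (C n)"
    if "I \<subseteq> B" "I \<noteq> {}" "\<And>b. b \<in> I \<Longrightarrow> c b \<noteq> 0" for I c
    unfolding g_def
  proof (rule chain_forms_independent[where k = "n * q"])
    show "finite I" using that finB finite_subset by blast
    show "C i \<subseteq> C (Suc i)" if "i < n" for i using inc[OF that] by blast
    show "b = b'" if "b \<in> I" "b' \<in> I" "\<And>j. j \<le> n \<Longrightarrow> a b j = a b' j" for b b'
      using inj[OF _ _ that(3)] that(1,2) \<open>I \<subseteq> B\<close> by blast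
    show "(\<Sum>j\<le>n. a b j) = n * q" if "b \<in> I" for b using deg that \<open>I \<subseteq> B\<close> by blast
  qed (use that sub F nv v in simp_all)
  have ginj: "inj_on g B"
  proof (rule inj_onI, rule ccontr)
    fix b b' assume b: "b \<in> B" "b' \<in> B" "g b = g b'" "b \<noteq> b'"
    \<comment> \<open>Two equal products would satisfy the relation with coefficients 1 and
      -1.\<close>
    have "\<not> vanishes_on (\<Sum>x\<in>{b, b'}. mpoly_scale (if x = b then 1 else -1) (g x)) (C n)"
      using b by (intro indep) auto
    thus False using b by (simp add: mpoly_scale_def single_uminus)
  qed
  have ind: "mpoly_vs.independent (g ` B)"
  proof (rule mpoly_vs.independent_if_scalars_zero)
    show "finite (g ` B)" using finB by simp
  next
    fix f x assume 0: "(\<Sum>x\<in>g ` B. mpoly_scale (f x) x) = 0" and "x \<in> g ` B"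
    then obtain b where b: "b \<in> B" "x = g b" by blast
    let ?I = "{b\<in>B. f (g b) \<noteq> 0}"
    have "(\<Sum>b\<in>?I. mpoly_scale (f (g b)) (g b)) = (\<Sum>b\<in>B. mpoly_scale (f (g b)) (g b))"
      using finB by (intro sum.mono_neutral_left) (auto simp: mpoly_scale_def)
    also have "\<dots> = 0" using 0 by (simp add: sum.reindex[OF ginj])
    finally have "?I = {}" using indep[of ?I "\<lambda>b. f (g b)"] by fastforce
    thus "f x = 0" using b by blast
  qed
  let ?T = "{\<mu>. Poly_Mapping.keys \<mu> \<subseteq> {..d} \<and> total_degree \<mu> = n * q * D}"
  have gf: "g b \<in> forms d (n * q * D)" if "b \<in> B" for b
  proof -
    have "g b \<in> forms d (\<Sum>j\<le>n. a b j * D)"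
      unfolding g_def using F by (intro forms_prod forms_power) auto
    thus ?thesis using deg[OF that] by (simp flip: sum_distrib_right)
  qed
  have "card (g ` B) \<le> card ((\<lambda>\<mu>. Poly_Mapping.single \<mu> (1::'k)) ` ?T)"
    using mpoly_vs.independent_span_bound[OF _ ind] card_exponents_le(1) forms_subset_span gf by blast
  also have "\<dots> \<le> card ?T" by (intro card_image_le card_exponents_le)
  also have "\<dots> \<le> (n * q * D + 1) ^ d" by (rule card_exponents_le)
  finally have "q ^ n \<le> (n * q * D + 1) ^ d" by (simp add: card_image[OF ginj] cardB)
  \<comment> \<open>From \<open>n * q * D + 1 \<le> q * (n * D + 1)\<close>; hence
    \<open>q ^ n < q ^ Suc d\<close>, against \<open>Suc d \<le> n\<close>.\<close>
  also have "\<dots> \<le> (q * (n * D + 1)) ^ d"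
    by (intro power_mono) (auto simp: q_def algebra_simps)
  also have "\<dots> = q ^ d * (n * D + 1) ^ d" by (rule power_mult_distrib)
  also have "\<dots> < q ^ d * q" by (intro mult_strict_left_mono) (simp_all add: q_def)
  also have "\<dots> = q ^ Suc d" by simp
  also have "\<dots> \<le> q ^ n" using dn by (intro power_increasing) (auto simp: q_def)
  finally show False by simp
qed

section \<open>The linear flag\<close>

text \<open>With \<open>x_0\<close> absent from the equations, the last member of the flag is (1 : 0
  : ... : 0) and \<open>x_0\<close> is a valid denominator along every member.\<close>

definition lin_subspace :: "nat \<Rightarrow> nat \<Rightarrow> 'k::field proj_point set" where
  "lin_subspace d i = {P \<in> proj_space d. \<forall>v\<in>P. \<forall>j\<in>{1..i}. v j = 0}"

lemma lin_subspace_0: "lin_subspace d 0 = proj_space d"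
  by (simp add: lin_subspace_def)

lemma lin_subspace_mono: "i \<le> k \<Longrightarrow> lin_subspace d k \<subseteq> lin_subspace d i"
  by (auto simp: lin_subspace_def)

lemma proj_pt_in_lin_subspace:
  assumes "v \<noteq> (\<lambda>_. 0)" "\<And>j. j > d \<Longrightarrow> v j = 0" "\<And>j. j \<in> {1..i} \<Longrightarrow> v j = 0"
  shows "proj_pt v \<in> lin_subspace d i"
  using proj_spaceI[OF assms(1,2)] assms(3) by (auto simp: lin_subspace_def proj_pt_def)

lemma unit_vector_in_lin_subspace:
  assumes "j \<le> d" "j \<notin> {1..i}"
  shows "proj_pt (\<lambda>l. if l = j then 1 else 0) \<in> lin_subspace d i"
  using assms by (intro proj_pt_in_lin_subspace) (auto simp: fun_eq_iff)

lemma lin_subspace_strict: "i < d \<Longrightarrow> lin_subspace d (Suc i) \<subset> (lin_subspace d i :: 'k::field proj_point set)"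
proof -
  assume "i < d"
  let ?P = "proj_pt (\<lambda>l. if l = Suc i then 1 else 0) :: 'k proj_point"
  have "?P \<in> lin_subspace d i" using \<open>i < d\<close> by (intro unit_vector_in_lin_subspace) auto
  moreover have "?P \<notin> lin_subspace d (Suc i)"
    using proj_pt_self[of "\<lambda>l. if l = Suc i then 1 else 0 :: 'k"] by (force simp: lin_subspace_def)
  moreover have "lin_subspace d (Suc i) \<subseteq> (lin_subspace d i :: 'k proj_point set)"
    by (rule lin_subspace_mono) simp
  ultimately show ?thesis by blast
qed

lemma lin_subspace_point: "lin_subspace d d = {proj_pt (\<lambda>l. if l = 0 then 1 else 0) :: 'k::field proj_point}"
proof -
  have "P = proj_pt (\<lambda>l. if l = 0 then 1 else 0)" if P: "P \<in> lin_subspace d d" for P :: "'k proj_point"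
  proof -
    have P': "P \<in> proj_space d" using P by (simp add: lin_subspace_def)
    obtain v where v: "v \<in> P" using proj_space_nonempty[OF P'] by blast
    have v0: "v j = 0" if "j \<noteq> 0" for j
      using P v proj_spaceE(3)[OF P' v, of j] that by (cases "j > d") (auto simp: lin_subspace_def)
    hence "v 0 \<noteq> 0" using proj_spaceE(2)[OF P' v] by metis
    hence "(\<lambda>l. if l = 0 then 1 else 0) = (\<lambda>l. inverse (v 0) * v l)"
      using v0 by (auto simp: fun_eq_iff)
    hence "(\<lambda>l. if l = 0 then 1 else 0) \<in> proj_pt v"
      using \<open>v 0 \<noteq> 0\<close> unfolding proj_pt_def by (intro CollectI exI[of _ "inverse (v 0)"]) auto
    hence "(\<lambda>l. if l = 0 then 1 else 0) \<in> P" using proj_spaceE(1)[OF P' v] by simp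
    thus ?thesis by (rule proj_spaceE(1)[OF P'])
  qed
  thus ?thesis using unit_vector_in_lin_subspace[of 0 d d] by force
qed

lemma lin_subspace_nonempty: "lin_subspace d i \<noteq> ({} :: 'k::field proj_point set)"
  using unit_vector_in_lin_subspace[of 0 d i] by force

lemma zariski_closed_lin_subspace:
  assumes "i \<le> d"
  shows "zariski_closed d (lin_subspace d i :: 'k::field proj_point set)"
  unfolding zariski_closed_def
proof (intro exI conjI)
  show "pvar ` {1..i} \<subseteq> (\<Union>m. forms d m :: 'k poly_ring set)"
  proof
    fix F :: "'k poly_ring" assume "F \<in> pvar ` {1..i}"
    then obtain j where "F = pvar j" "j \<le> d" using assms by auto
    thus "F \<in> (\<Union>m. forms d m)" using forms_pvar[of j d] by blast
  qed
  show "lin_subspace d i = {P \<in> proj_space d. \<forall>F\<in>pvar ` {1..i}. vanishes_on F {P :: 'k proj_point}}"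
    unfolding lin_subspace_def vanishes_on_def by simp blast
qed

lemma monom_val_eq_0:
  assumes "j \<in> Poly_Mapping.keys \<mu>" "v j = 0"
  shows "monom_val v \<mu> = 0"
  using assms by (auto simp: monom_val_def in_keys_iff intro!: bexI[of _ j])

lemma vanishes_on_lin_subspaceI:
  fixes F :: "'k::field poly_ring"
  assumes "\<And>\<mu>. \<mu> \<in> Poly_Mapping.keys F \<Longrightarrow> Poly_Mapping.keys \<mu> \<inter> {1..i} \<noteq> {}"
  shows "vanishes_on F (lin_subspace d i)"
  unfolding vanishes_on_def
proof (intro ballI)
  fix P and v :: "nat \<Rightarrow> 'k" assume P: "P \<in> lin_subspace d i" "v \<in> P"
  have "Poly_Mapping.lookup F \<mu> * monom_val v \<mu> = 0" if \<mu>: "\<mu> \<in> Poly_Mapping.keys F" for \<mu>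
  proof -
    obtain j where "j \<in> Poly_Mapping.keys \<mu>" "j \<in> {1..i}" using assms[OF \<mu>] by blast
    moreover have "v j = 0" using P \<open>j \<in> {1..i}\<close> by (simp add: lin_subspace_def)
    ultimately show ?thesis using monom_val_eq_0[of j \<mu> v] by simp
  qed
  thus "eval_poly F v = 0" unfolding eval_poly_altdef by (intro sum.neutral) blast
qed

text \<open>The ideal of the subspace is the monomial ideal of \<open>x_1\<close>, ...,
  \<open>x_i\<close>: the part \<open>R\<close> of \<open>F\<close> free of these variables also
  vanishes there, and a nonzero \<open>R\<close> would be nonzero at a point supported on the other
  coordinates.\<close>

lemma vanishes_on_lin_subspaceD:
  fixes F :: "'k::field poly_ring"
  assumes inf: "infinite (UNIV :: 'k set)" and F: "F \<in> forms d m"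
    and van: "vanishes_on F (lin_subspace d i)" and \<mu>: "\<mu> \<in> Poly_Mapping.keys F"
  shows "Poly_Mapping.keys \<mu> \<inter> {1..i} \<noteq> {}"
proof
  assume disj: "Poly_Mapping.keys \<mu> \<inter> {1..i} = {}"
  define M where "M = {\<mu>\<in>Poly_Mapping.keys F. Poly_Mapping.keys \<mu> \<inter> {1..i} = {}}"
  define R where "R = (\<Sum>\<mu>\<in>M. Poly_Mapping.single \<mu> (Poly_Mapping.lookup F \<mu>))"
  have fin: "finite M" by (simp add: M_def)
  have lR: "Poly_Mapping.lookup R \<nu> = (if \<nu> \<in> M then Poly_Mapping.lookup F \<nu> else 0)" for \<nu>
    using fin by (simp add: R_def lookup_sum lookup_single when_def)
  have kR: "Poly_Mapping.keys R \<subseteq> M" by (auto simp: in_keys_iff lR split: if_splits)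
  have FR: "vanishes_on (F - R) (lin_subspace d i)"
  proof (rule vanishes_on_lin_subspaceI)
    fix \<nu> assume "\<nu> \<in> Poly_Mapping.keys (F - R)"
    hence "\<nu> \<in> Poly_Mapping.keys F \<and> \<nu> \<notin> M"
      unfolding in_keys_iff lookup_minus lR by (auto split: if_splits)
    thus "Poly_Mapping.keys \<nu> \<inter> {1..i} \<noteq> {}" by (auto simp: M_def)
  qed
  have van_R: "vanishes_on R (lin_subspace d i)" using vanishes_on_diff[OF van FR] by simp
  have "\<mu> \<in> M" using \<mu> disj by (simp add: M_def)
  hence "Poly_Mapping.lookup R \<mu> \<noteq> 0" using \<mu> by (simp add: lR in_keys_iff)
  hence "R \<noteq> 0" by auto
  moreover have "pvar 0 \<noteq> (0 :: 'k poly_ring)"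
    using eval_poly_pvar[of 0 "\<lambda>_. 1 :: 'k"] by fastforce
  \<comment> \<open>The factor \<open>x_0\<close> makes the vector found below nonzero, hence a
    projective point, even when \<open>R\<close> is constant.\<close>
  ultimately have "R * pvar 0 \<noteq> 0" by simp
  moreover have "Poly_Mapping.keys \<nu> \<subseteq> {..d} - {1..i}" if "\<nu> \<in> Poly_Mapping.keys (R * pvar 0)" for \<nu>
  proof -
    obtain a where a: "a \<in> Poly_Mapping.keys R" "\<nu> = a + Poly_Mapping.single 0 1"
      using keys_mult[of R "pvar 0"] \<open>\<nu> \<in> _\<close> by (auto simp: pvar_def split: if_splits)
    have "a \<in> M" using a kR by blast
    hence "Poly_Mapping.keys a \<subseteq> {..d}" "Poly_Mapping.keys a \<inter> {1..i} = {}"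
      using F by (auto simp: M_def forms_altdef)
    thus ?thesis by (auto simp: a(2) keys_add_nat)
  qed
  ultimately obtain v where v: "eval_poly (R * pvar 0) v \<noteq> 0" "\<And>j. j \<notin> {..d} - {1..i} \<Longrightarrow> v j = 0"
    using eval_poly_nonzero_point[OF inf, of "R * pvar 0" "{..d} - {1..i}"] by blast
  have "v 0 \<noteq> 0" "eval_poly R v \<noteq> 0" using v(1) by auto
  hence "proj_pt v \<in> lin_subspace d i" using v(2)
    by (intro proj_pt_in_lin_subspace) auto
  thus False using van_R \<open>eval_poly R v \<noteq> 0\<close> proj_pt_self[of v] by (auto simp: vanishes_on_def)
qed

text \<open>Irreducibility: two forms that are nonzero at points \<open>p\<close> and \<open>q\<close> of the subspace are
  simultaneously nonzero at almost all points of the line through \<open>p\<close> and \<open>q\<close>.\<close>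

lemma subvariety_lin_subspace:
  assumes inf: "infinite (UNIV :: 'k::field set)" and "i \<le> d"
  shows "subvariety d (lin_subspace d i :: 'k proj_point set)"
proof (rule subvarietyI[OF zariski_closed_lin_subspace[OF \<open>i \<le> d\<close>] lin_subspace_nonempty], rule ccontr)
  fix F G :: "'k poly_ring" and m n
  assume F: "F \<in> forms d m" and G: "G \<in> forms d n" and FG: "vanishes_on (F * G) (lin_subspace d i)"
    and "\<not> (vanishes_on F (lin_subspace d i) \<or> vanishes_on G (lin_subspace d i))"
  then obtain P p Q q where p: "P \<in> lin_subspace d i" "p \<in> P" "eval_poly F p \<noteq> 0"
      and q: "Q \<in> lin_subspace d i" "q \<in> Q" "eval_poly G q \<noteq> 0"
    by (auto simp: vanishes_on_def)
  have P: "P \<in> proj_space d" and Q: "Q \<in> proj_space d" using p q by (auto simp: lin_subspace_def)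
  obtain j0 where j0: "p j0 \<noteq> 0" using proj_spaceE(2)[OF P p(2)] by auto
  let ?w = "\<lambda>z j. p j + z * (q j - p j)"
  obtain f where f: "\<And>z. poly f z = eval_poly F (?w z)" using eval_poly_on_line by metis
  obtain g where g: "\<And>z. poly g z = eval_poly G (?w z)" using eval_poly_on_line by metis
  have "poly f 0 \<noteq> 0" "poly g 1 \<noteq> 0" using p q f g by simp_all
  hence "f \<noteq> 0" "g \<noteq> 0" by auto
  \<comment> \<open>The third factor keeps coordinate \<open>j0\<close> nonzero, so that the vector
    on the line represents a point.\<close>
  moreover have "[:p j0, q j0 - p j0:] \<noteq> 0" using j0 by simp
  ultimately have "f * g * [:p j0, q j0 - p j0:] \<noteq> 0" by (intro no_zero_divisors)
  then obtain z where z: "poly (f * g * [:p j0, q j0 - p j0:]) z \<noteq> 0"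
    using inf poly_roots_finite[of "f * g * [:p j0, q j0 - p j0:]"] by fastforce
  hence z: "poly f z \<noteq> 0" "poly g z \<noteq> 0" "poly [:p j0, q j0 - p j0:] z \<noteq> 0"
    unfolding poly_mult by auto
  have "?w z j0 \<noteq> 0" using z(3) by simp
  hence "?w z \<noteq> (\<lambda>_. 0)" by metis
  moreover have "?w z j = 0" if "j > d" for j
    using that proj_spaceE(3)[OF P p(2)] proj_spaceE(3)[OF Q q(2)] by simp
  moreover have "?w z j = 0" if "j \<in> {1..i}" for j
  proof -
    have "p j = 0" "q j = 0" using that p q unfolding lin_subspace_def by blast+
    thus ?thesis by simp
  qed
  ultimately have "proj_pt (?w z) \<in> lin_subspace d i" by (rule proj_pt_in_lin_subspace)
  hence "eval_poly (F * G) (?w z) = 0" using FG proj_pt_self[of "?w z"] by (auto simp: vanishes_on_def)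
  thus False using z(1,2) f g by simp
qed

text \<open>Flag members below and above complete the chain to one of length
  \<open>n + d - k\<close> in projective space, where the absolute bound \<open>d\<close>
  applies.\<close>

lemma lin_subspace_chain_le:
  fixes C :: "nat \<Rightarrow> 'k::field proj_point set"
  assumes inf: "infinite (UNIV :: 'k set)" and ik: "i + k \<le> d"
    and C: "C 0 = lin_subspace d (i + k)" "C n \<subseteq> lin_subspace d i"
      "\<And>l. l \<le> n \<Longrightarrow> subvariety d (C l)" "\<And>l. l < n \<Longrightarrow> C l \<subset> C (Suc l)"
  shows "n \<le> k"
proof -
  \<comment> \<open>The number of flag steps from the point up to
    \<open>lin_subspace d (i + k)\<close>.\<close>
  define a where "a = d - (i + k)"
  define E where "E l = (if l < a then lin_subspace d (d - l) else if l \<le> a + n then C (l - a)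
      else lin_subspace d (i - (l - (a + n))))" for l
  have "subvariety d (E l)" if "l \<le> a + n + i" for l
    unfolding E_def using that ik by (auto intro!: C(3) subvariety_lin_subspace[OF inf])
  moreover have "E l \<subset> E (Suc l)" if "l < a + n + i" for l
  proof -
    consider "Suc l < a" | "Suc l = a" | "a \<le> l" "l < a + n" | "l = a + n" | "l > a + n" by linarith
    thus ?thesis
    proof cases
      case 1
      thus ?thesis using lin_subspace_strict[of "d - Suc l" d, where ?'k = 'k]
        by (simp add: E_def a_def Suc_diff_Suc)
    next
      case 2
      hence "d - l = Suc (i + k)" "i + k < d" by (auto simp: a_def)
      thus ?thesis using 2 lin_subspace_strict[of "i + k" d, where ?'k = 'k] C(1) by (simp add: E_def)
    next
      case 3
      thus ?thesis using C(4)[of "l - a"] by (simp add: E_def Suc_diff_le)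
    next
      case 4
      hence "i > 0" using that by simp
      \<comment> \<open>\<open>C n\<close> may equal \<open>lin_subspace d i\<close>, so the
        continuation starts with the next larger member.\<close>
      hence "lin_subspace d i \<subset> (lin_subspace d (i - 1) :: 'k proj_point set)"
        using lin_subspace_strict[of "i - 1" d, where ?'k = 'k] ik by simp
      thus ?thesis using 4 C(2) by (simp add: E_def)
    next
      case 5
      hence "i - (l - (a + n)) = Suc (i - (Suc l - (a + n)))" using that by auto
      thus ?thesis using 5 ik lin_subspace_strict[of "i - (Suc l - (a + n))" d, where ?'k = 'k]
        by (simp add: E_def)
    qed
  qed
  ultimately have "a + n + i \<le> d" by (rule subvariety_chain_length_le)
  thus ?thesis using ik by (simp add: a_def)
qed

lemma codim_lin_subspace:
  assumes inf: "infinite (UNIV :: 'k::field set)" and ik: "i + k \<le> d"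
  shows "codim d (lin_subspace d (i + k)) (lin_subspace d i :: 'k proj_point set) = enat k"
  unfolding codim_def
proof (rule antisym)
  let ?S = "{enat n |n. \<exists>C. C 0 = lin_subspace d (i + k) \<and> C n \<subseteq> (lin_subspace d i :: 'k proj_point set) \<and>
    (\<forall>i\<le>n. subvariety d (C i)) \<and> (\<forall>i<n. C i \<subset> C (Suc i))}"
  show "Sup ?S \<le> enat k"
    using lin_subspace_chain_le[OF inf ik] by (intro Sup_least) force
  show "enat k \<le> Sup ?S"
  proof (rule Sup_upper, rule CollectI, rule exI[of _ k], intro conjI exI[of _ "\<lambda>l. lin_subspace d (i + k - l)"])
    show "\<forall>l<k. lin_subspace d (i + k - l) \<subset> (lin_subspace d (i + k - Suc l) :: 'k proj_point set)"
    proof (intro allI impI)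
      fix l assume "l < k"
      hence "i + k - l = Suc (i + k - Suc l)" by simp
      thus "lin_subspace d (i + k - l) \<subset> (lin_subspace d (i + k - Suc l) :: 'k proj_point set)"
        using lin_subspace_strict[of "i + k - Suc l" d, where ?'k = 'k] ik \<open>l < k\<close> by simp
    qed
  qed (use ik subvariety_lin_subspace[OF inf] in auto)
qed

section \<open>Local rings and orders of vanishing\<close>

lemma loc_ringI: "F \<in> forms d m \<Longrightarrow> G \<in> forms d m \<Longrightarrow> \<not> vanishes_on G Z \<Longrightarrow> Fract F G \<in> loc_ring d Z"
  by (auto simp: loc_ring_def)

lemma loc_ringE:
  assumes "f \<in> loc_ring d Z"
  obtains F G m where "f = Fract F G" "F \<in> forms d m" "G \<in> forms d m" "\<not> vanishes_on G Z"
  using assms by (auto simp: loc_ring_def)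

lemma loc_idealI:
  "F \<in> forms d m \<Longrightarrow> G \<in> forms d m \<Longrightarrow> vanishes_on F Y \<Longrightarrow> \<not> vanishes_on G Z \<Longrightarrow> Fract F G \<in> loc_ideal d Z Y"
  by (auto simp: loc_ideal_def)

lemma loc_idealE:
  assumes "f \<in> loc_ideal d Z Y"
  obtains F G m where "f = Fract F G" "F \<in> forms d m" "G \<in> forms d m" "vanishes_on F Y" "\<not> vanishes_on G Z"
  using assms by (auto simp: loc_ideal_def)

lemma not_vanishes_nonzero: "\<not> vanishes_on G Z \<Longrightarrow> G \<noteq> 0"
  by auto

lemma loc_ideal_subset_ring: "loc_ideal d Z Y \<subseteq> loc_ring d Z"
  by (auto simp: loc_ring_def loc_ideal_def)

lemma loc_ring_mono: "Z \<subseteq> Z' \<Longrightarrow> loc_ring d Z \<subseteq> loc_ring d Z'"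
  unfolding loc_ring_def using vanishes_on_subset by blast

lemma loc_ideal_mono: "Z \<subseteq> Z' \<Longrightarrow> Y' \<subseteq> Y \<Longrightarrow> loc_ideal d Z Y \<subseteq> loc_ideal d Z' Y'"
  unfolding loc_ideal_def using vanishes_on_subset by blast

lemma not_vanishes_mult:
  assumes "subvariety d Z" "F \<in> forms d m" "G \<in> forms d n" "\<not> vanishes_on F Z" "\<not> vanishes_on G Z"
  shows "\<not> vanishes_on (F * G) Z"
  using subvariety_vanishes_mult[OF assms(1-3)] assms(4,5) by blast

lemma one_in_loc_ring:
  assumes Z: "subvariety d Z"
  shows "1 \<in> loc_ring d Z"
proof -
  have "\<not> vanishes_on 1 Z"
    using subvariety_vanishes_power[OF Z zero_in_forms[of d 0], of 0]
      subvariety_vanishes_power[OF Z one_in_forms, of 0] Z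
      proj_space_nonempty subvariety_subset[OF Z] by (fastforce simp: subvariety_def vanishes_on_def)
  thus ?thesis unfolding One_fract_def by (intro loc_ringI[of _ _ 0]) auto
qed

lemma loc_ring_mult:
  assumes Z: "subvariety d Z" and "f \<in> loc_ring d Z" "g \<in> loc_ring d Z"
  shows "f * g \<in> loc_ring d Z"
proof -
  obtain F G m where f: "f = Fract F G" "F \<in> forms d m" "G \<in> forms d m" "\<not> vanishes_on G Z"
    using assms(2) by (rule loc_ringE)
  obtain F' G' m' where g: "g = Fract F' G'" "F' \<in> forms d m'" "G' \<in> forms d m'" "\<not> vanishes_on G' Z"
    using assms(3) by (rule loc_ringE)
  show ?thesis unfolding f g mult_fract
    using f g by (intro loc_ringI[of _ _ "m + m'"] forms_mult not_vanishes_mult[OF Z])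
qed

lemma loc_ring_diff:
  assumes Z: "subvariety d Z" and "f \<in> loc_ring d Z" "g \<in> loc_ring d Z"
  shows "f - g \<in> loc_ring d Z"
proof -
  obtain F G m where f: "f = Fract F G" "F \<in> forms d m" "G \<in> forms d m" "\<not> vanishes_on G Z"
    using assms(2) by (rule loc_ringE)
  obtain F' G' m' where g: "g = Fract F' G'" "F' \<in> forms d m'" "G' \<in> forms d m'" "\<not> vanishes_on G' Z"
    using assms(3) by (rule loc_ringE)
  have "F' * G \<in> forms d (m + m')" using forms_mult[OF f(3) g(2)] by (simp add: mult.commute)
  hence "F * G' - F' * G \<in> forms d (m + m')" using forms_mult[OF f(2) g(3)] by (intro forms_diff)
  moreover have "f - g = Fract (F * G' - F' * G) (G * G')"
    using f g not_vanishes_nonzero by (metis diff_fract)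
  ultimately show ?thesis
    using loc_ringI forms_mult[OF f(3) g(3)] not_vanishes_mult[OF Z f(3) g(3) f(4) g(4)] by metis
qed

lemma loc_ring_power: "subvariety d Z \<Longrightarrow> f \<in> loc_ring d Z \<Longrightarrow> f ^ k \<in> loc_ring d Z"
  by (induction k) (auto intro: one_in_loc_ring loc_ring_mult)

lemma loc_ideal_mult:
  assumes Z: "subvariety d Z" and "f \<in> loc_ring d Z" "g \<in> loc_ideal d Z Y"
  shows "f * g \<in> loc_ideal d Z Y"
proof -
  obtain F G m where f: "f = Fract F G" "F \<in> forms d m" "G \<in> forms d m" "\<not> vanishes_on G Z"
    using assms(2) by (rule loc_ringE)
  obtain F' G' m' where g: "g = Fract F' G'" "F' \<in> forms d m'" "G' \<in> forms d m'" "vanishes_on F' Y" "\<not> vanishes_on G' Z"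
    using assms(3) by (rule loc_idealE)
  show ?thesis unfolding f g mult_fract
    using f g by (intro loc_idealI[of _ _ "m + m'"] forms_mult not_vanishes_mult[OF Z] vanishes_on_mult disjI2)
qed

lemma loc_ideal_add:
  assumes Z: "subvariety d Z" and "f \<in> loc_ideal d Z Y" "g \<in> loc_ideal d Z Y"
  shows "f + g \<in> loc_ideal d Z Y"
proof -
  obtain F G m where f: "f = Fract F G" "F \<in> forms d m" "G \<in> forms d m" "vanishes_on F Y" "\<not> vanishes_on G Z"
    using assms(2) by (rule loc_idealE)
  obtain F' G' m' where g: "g = Fract F' G'" "F' \<in> forms d m'" "G' \<in> forms d m'" "vanishes_on F' Y" "\<not> vanishes_on G' Z"
    using assms(3) by (rule loc_idealE)
  have "F' * G \<in> forms d (m + m')" using forms_mult[OF f(3) g(2)] by (simp add: mult.commute)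
  hence "F * G' + F' * G \<in> forms d (m + m')" using forms_mult[OF f(2) g(3)] by (intro forms_add)
  moreover have "vanishes_on (F * G' + F' * G) Y"
    using f g by (intro vanishes_on_add vanishes_on_mult) auto
  moreover have "f + g = Fract (F * G' + F' * G) (G * G')"
    using f g not_vanishes_nonzero by (metis add_fract)
  ultimately show ?thesis
    using loc_idealI forms_mult[OF f(3) g(3)] not_vanishes_mult[OF Z f(3) g(3) f(5) g(5)] by metis
qed

lemma minus_one_in_loc_ring: "subvariety d Z \<Longrightarrow> - 1 \<in> loc_ring d Z"
  using loc_ring_diff[of d Z 0 1] loc_ring_diff[of d Z 1 1] one_in_loc_ring[of d Z] by simp

lemma loc_ideal_diff:
  assumes Z: "subvariety d Z" and "f \<in> loc_ideal d Z Y" "g \<in> loc_ideal d Z Y"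
  shows "f - g \<in> loc_ideal d Z Y"
  using loc_ideal_add[OF Z assms(2) loc_ideal_mult[OF Z minus_one_in_loc_ring[OF Z] assms(3)]] by simp

lemma loc_ideal_diff_cancel:
  assumes "subvariety d Z" "f - g \<in> loc_ideal d Z Y" "g \<in> loc_ideal d Z Y"
  shows "f \<in> loc_ideal d Z Y"
  using loc_ideal_add[OF assms] by simp

text \<open>\<open>loc_ideal\<close> only asks for some representation as a fraction.
  Cross-multiplying and primality show that any one decides, since denominators do not vanish on
  \<open>Y\<close>.\<close>

lemma Fract_in_loc_ideal_iff:
  assumes Y: "subvariety d Y" and ZY: "Z \<subseteq> Y"
    and F: "F \<in> forms d m" and G: "G \<in> forms d m" "\<not> vanishes_on G Z"
  shows "Fract F G \<in> loc_ideal d Z Y \<longleftrightarrow> vanishes_on F Y"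
proof
  assume "Fract F G \<in> loc_ideal d Z Y"
  then obtain F' G' m' where *: "Fract F G = Fract F' G'" "F' \<in> forms d m'" "G' \<in> forms d m'"
      "vanishes_on F' Y" "\<not> vanishes_on G' Z"
    by (rule loc_idealE)
  have "F * G' = F' * G" using * G not_vanishes_nonzero by (metis eq_fract(1))
  hence "vanishes_on (F * G') Y" using * by (auto intro: vanishes_on_mult)
  moreover have "\<not> vanishes_on G' Y" using * ZY vanishes_on_subset by blast
  ultimately show "vanishes_on F Y" using subvariety_vanishes_mult[OF Y F *(3)] by blast
qed (use assms in \<open>auto intro: loc_idealI\<close>)

lemma loc_ideal_prime:
  assumes Y: "subvariety d Y" and Z: "subvariety d Z" and ZY: "Z \<subseteq> Y"
    and "f \<in> loc_ring d Z" "g \<in> loc_ring d Z" and fg: "f * g \<in> loc_ideal d Z Y"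
  shows "f \<in> loc_ideal d Z Y \<or> g \<in> loc_ideal d Z Y"
proof -
  obtain F G m where f: "f = Fract F G" "F \<in> forms d m" "G \<in> forms d m" "\<not> vanishes_on G Z"
    using assms(4) by (rule loc_ringE)
  obtain F' G' m' where g: "g = Fract F' G'" "F' \<in> forms d m'" "G' \<in> forms d m'" "\<not> vanishes_on G' Z"
    using assms(5) by (rule loc_ringE)
  have "vanishes_on (F * F') Y"
    using fg unfolding f(1) g(1) mult_fract
      Fract_in_loc_ideal_iff[OF Y ZY forms_mult[OF f(2) g(2)] forms_mult[OF f(3) g(3)]
        not_vanishes_mult[OF Z f(3) g(3) f(4) g(4)]] .
  hence "vanishes_on F Y \<or> vanishes_on F' Y" using subvariety_vanishes_mult[OF Y] f g by blast
  thus ?thesis using f g loc_idealI by blast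
qed

lemma one_not_in_loc_ideal:
  assumes Y: "subvariety d Y" and Z: "subvariety d Z" and ZY: "Z \<subseteq> Y"
  shows "1 \<notin> loc_ideal d Z Y"
proof
  assume 1: "1 \<in> loc_ideal d Z Y"
  obtain F G m where *: "(1 :: 'a poly_ring fract) = Fract F G" "F \<in> forms d m" "G \<in> forms d m" "\<not> vanishes_on G Z"
    using one_in_loc_ring[OF Z] by (rule loc_ringE)
  hence "Fract F G = Fract 1 1" using One_fract_def by metis
  hence "F = G" using not_vanishes_nonzero[OF *(4)] by (simp add: eq_fract)
  moreover have "vanishes_on F Y" using 1 Fract_in_loc_ideal_iff[OF Y ZY *(2-4)] * by simp
  ultimately show False using *(4) ZY vanishes_on_subset by blast
qed

lemma loc_ideal_prime_power:
  assumes Y: "subvariety d Y" and Z: "subvariety d Z" and ZY: "Z \<subseteq> Y"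
    and f: "f \<in> loc_ring d Z" and "f ^ k \<in> loc_ideal d Z Y"
  shows "f \<in> loc_ideal d Z Y"
  using assms(5)
proof (induction k)
  case 0
  thus ?case using one_not_in_loc_ideal[OF Y Z ZY] by simp
next
  case (Suc k)
  thus ?case using loc_ideal_prime[OF Y Z ZY f loc_ring_power[OF Z f]] by auto
qed

lemma loc_ideal_power_diff:
  assumes Z: "subvariety d Z" and "a \<in> loc_ring d Z" "b \<in> loc_ring d Z" "a - b \<in> loc_ideal d Z Y"
  shows "a ^ k - b ^ k \<in> loc_ideal d Z Y"
proof (induction k)
  case 0
  have "0 * (a - b) \<in> loc_ideal d Z Y"
    using loc_ideal_diff[OF Z assms(4) assms(4)] by simp
  thus ?case by simp
next
  case (Suc k)
  have "a ^ Suc k - b ^ Suc k = a * (a ^ k - b ^ k) + b ^ k * (a - b)" by (simp add: algebra_simps)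
  thus ?case using Suc assms loc_ring_power[OF Z]
    by (auto intro!: loc_ideal_add[OF Z] loc_ideal_mult[OF Z])
qed

text \<open>Outside the maximal ideal the numerator does not vanish on \<open>Z\<close> either, so
  numerator and denominator can be swapped.\<close>

lemma loc_ring_inverse:
  assumes f: "f \<in> loc_ring d Z" "f \<notin> loc_ideal d Z Z"
  shows "inverse f \<in> loc_ring d Z" "f \<noteq> 0"
proof -
  obtain F G m where *: "f = Fract F G" "F \<in> forms d m" "G \<in> forms d m" "\<not> vanishes_on G Z"
    using f(1) by (rule loc_ringE)
  have "\<not> vanishes_on F Z" using f(2) * loc_idealI by blast
  thus "inverse f \<in> loc_ring d Z" unfolding * inverse_fract using * by (intro loc_ringI)
  show "f \<noteq> 0" using * not_vanishes_nonzero[OF \<open>\<not> vanishes_on F Z\<close>] not_vanishes_nonzero[OF *(4)]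
    by (simp add: Zero_fract_def eq_fract)
qed

lemma exists_nonvanishing_form:
  assumes Z: "subvariety d Z"
  obtains G where "G \<in> forms d m" "\<not> vanishes_on G Z"
proof -
  obtain P where "P \<in> Z" using Z by (auto simp: subvariety_def)
  hence P: "P \<in> proj_space d" using subvariety_subset[OF Z] by blast
  obtain v where v: "v \<in> P" using proj_space_nonempty[OF P] by blast
  obtain j where j: "v j \<noteq> 0" using proj_spaceE(2)[OF P v] by auto
  hence "j \<le> d" using proj_spaceE(3)[OF P v] by (meson not_le)
  hence "pvar j ^ m \<in> forms d (m * 1)" by (intro forms_power forms_pvar)
  moreover have "\<not> vanishes_on (pvar j ^ m) Z"
    using j v \<open>P \<in> Z\<close> by (auto simp: vanishes_on_def)
  ultimately show ?thesis using that by simp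
qed

text \<open>Otherwise the whole ideal of \<open>D\<close> would lie in that of \<open>Y\<close>, but
  a strict inclusion yields a form vanishing on \<open>D\<close> and not on
  \<open>Y\<close>.\<close>

lemma local_equation_not_in_ideal:
  assumes Y: "subvariety d Y" and D: "subvariety d D" and Z: "subvariety d Z"
    and ZD: "Z \<subseteq> D" and DY: "D \<subset> Y" and t: "local_equation d Z Y D t"
  shows "t \<notin> loc_ideal d Z Y"
proof
  assume t': "t \<in> loc_ideal d Z Y"
  have "zariski_closed d D" "Y \<subseteq> proj_space d" "\<not> Y \<subseteq> D"
    using D subvariety_subset[OF Y] DY by (auto simp: subvariety_def)
  then obtain F m where F: "F \<in> forms d m" "vanishes_on F D" "\<not> vanishes_on F Y"
    by (rule zariski_closed_separate)
  obtain G where G: "G \<in> forms d m" "\<not> vanishes_on G Z" using Z by (rule exists_nonvanishing_form)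
  have "Fract F G \<in> loc_ideal d Z D" using F G by (intro loc_idealI)
  then obtain a where "a \<in> loc_ring d Z" "Fract F G - a * t \<in> loc_ideal d Z Y"
    using t by (auto simp: local_equation_def)
  hence "Fract F G \<in> loc_ideal d Z Y"
    using loc_ideal_diff_cancel[OF Z] loc_ideal_mult[OF Z] t' by blast
  moreover have "Z \<subseteq> Y" using ZD DY by blast
  ultimately show False using F G Fract_in_loc_ideal_iff[OF Y] by blast
qed

text \<open>Modulo the ideal of \<open>Y\<close> one has \<open>t' = a * t\<close>. Comparing the
  expansions and cancelling \<open>t ^ k\<close> by primality puts the unit \<open>u\<close> into
  the maximal ideal.\<close>

lemma ord_along_unique_aux:
  assumes Y: "subvariety d Y" and D: "subvariety d D" and DY: "D \<subset> Y"
    and t: "local_equation d D Y D t" "u \<in> loc_ring d D" "u \<notin> loc_ideal d D D" "f - u * t ^ k \<in> loc_ideal d D Y"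
    and t': "local_equation d D Y D t'" "u' \<in> loc_ring d D" "f - u' * t' ^ k' \<in> loc_ideal d D Y"
    and "k < k'"
  shows False
proof -
  have sub: "D \<subseteq> Y" using DY by blast
  have tD: "t \<in> loc_ideal d D D" "t' \<in> loc_ideal d D D" using t t' by (auto simp: local_equation_def)
  hence tR: "t \<in> loc_ring d D" "t' \<in> loc_ring d D" using loc_ideal_subset_ring by blast+
  obtain a where a: "a \<in> loc_ring d D" "t' - a * t \<in> loc_ideal d D Y"
    using t(1) tD(2) by (auto simp: local_equation_def)
  have 1: "t' ^ k' - (a * t) ^ k' \<in> loc_ideal d D Y"
    using a tR by (intro loc_ideal_power_diff[OF D] loc_ring_mult[OF D])
  define r where "r = k' - Suc k"
  have k': "k' = k + Suc r" using \<open>k < k'\<close> by (simp add: r_def)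
  \<comment> \<open>The second expansion divided by \<open>t ^ k\<close>; at least one factor
    \<open>t\<close> is left, so it lies in the maximal ideal.\<close>
  define b where "b = u' * a ^ k' * t ^ Suc r"
  have bD: "b \<in> loc_ideal d D D"
    unfolding b_def power_Suc2 mult.assoc[symmetric]
    using t' a tR tD by (intro loc_ideal_mult[OF D] loc_ring_mult[OF D] loc_ring_power[OF D])
  have "(f - u' * t' ^ k') - (f - u * t ^ k) + u' * (t' ^ k' - (a * t) ^ k') = t ^ k * (u - b)"
    unfolding b_def k' by (simp add: algebra_simps power_add)
  hence "t ^ k * (u - b) \<in> loc_ideal d D Y"
    using loc_ideal_add[OF D loc_ideal_diff[OF D t'(3) t(4)] loc_ideal_mult[OF D t'(2) 1]] by simp
  moreover have "u - b \<in> loc_ring d D"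
    using loc_ring_diff[OF D t(2)] bD loc_ideal_subset_ring by blast
  ultimately have "t \<in> loc_ideal d D Y \<or> u - b \<in> loc_ideal d D Y"
    using loc_ideal_prime[OF Y D sub loc_ring_power[OF D tR(1)]] loc_ideal_prime_power[OF Y D sub tR(1)]
    by blast
  moreover have "t \<notin> loc_ideal d D Y"
    using local_equation_not_in_ideal[OF Y D D _ DY t(1)] by simp
  ultimately have "u - b \<in> loc_ideal d D D" using loc_ideal_mono[of D D D Y] sub by blast
  hence "u \<in> loc_ideal d D D" using bD by (rule loc_ideal_diff_cancel[OF D])
  thus False using t(3) by simp
qed

text \<open>Turns the definite description into a computation: a single expansion determines the
  order.\<close>

lemma ord_along_eqI:
  assumes Y: "subvariety d Y" and D: "subvariety d D" and DY: "D \<subset> Y"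
    and t: "local_equation d D Y D t" "u \<in> loc_ring d D" "u \<notin> loc_ideal d D D" "f - u * t ^ k \<in> loc_ideal d D Y"
  shows "ord_along d Y D f = k"
  unfolding ord_along_def
proof (rule the_equality)
  show "\<exists>t u. local_equation d D Y D t \<and> u \<in> loc_ring d D \<and> u \<notin> loc_ideal d D D \<and>
      f - u * t ^ k \<in> loc_ideal d D Y"
    using t by blast
next
  fix k' assume "\<exists>t u. local_equation d D Y D t \<and> u \<in> loc_ring d D \<and> u \<notin> loc_ideal d D D \<and>
      f - u * t ^ k' \<in> loc_ideal d D Y"
  then obtain t' u' where t': "local_equation d D Y D t'" "u' \<in> loc_ring d D" "u' \<notin> loc_ideal d D D"
      "f - u' * t' ^ k' \<in> loc_ideal d D Y"
    by blast
  show "k' = k"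
    using ord_along_unique_aux[OF Y D DY t t'(1,2,4)] ord_along_unique_aux[OF Y D DY t' t(1,2,4)]
    by (metis nat_neq_iff)
qed

section \<open>The linear flag is admissible\<close>

text \<open>An affine coordinate of the chart where \<open>x_0\<close> is nonzero, indexed by the
  flag step from \<open>Y_i\<close> to \<open>Y_(i+1)\<close> that it cuts out.\<close>

definition lin_coord :: "nat \<Rightarrow> 'k::field poly_ring fract" where
  "lin_coord i = Fract (pvar (Suc i)) (pvar 0)"

lemma pvar_0_not_vanishes: "\<not> vanishes_on (pvar 0 :: 'k::field poly_ring) (lin_subspace d i)"
proof -
  have "proj_pt (\<lambda>l. if l = 0 then 1 else 0 :: 'k) \<in> lin_subspace d i"
    by (rule unit_vector_in_lin_subspace) auto
  thus ?thesis using proj_pt_self[of "\<lambda>l. if l = 0 then 1 else 0 :: 'k"]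
    by (force simp: vanishes_on_def)
qed

lemma pvar_0_nonzero: "pvar 0 \<noteq> (0 :: 'k::field poly_ring)"
  using pvar_0_not_vanishes not_vanishes_nonzero by blast

lemma pvar_0_power:
  "pvar 0 ^ n \<in> forms d n" "\<not> vanishes_on (pvar 0 ^ n :: 'k::field poly_ring) (lin_subspace d i)"
proof -
  show "pvar 0 ^ n \<in> forms d n" using forms_power[OF forms_pvar[of 0 d], of n] by simp
  show "\<not> vanishes_on (pvar 0 ^ n :: 'k::field poly_ring) (lin_subspace d i)"
    using pvar_0_not_vanishes[of d i, where ?'k = 'k] by (auto simp: vanishes_on_def)
qed

lemma pvar_vanishes_lin_subspace: "j \<in> {1..i} \<Longrightarrow> vanishes_on (pvar j) (lin_subspace d i)"
  unfolding vanishes_on_def lin_subspace_def by simp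

text \<open>Divide the numerator by \<open>x_(i+1)\<close>: every monomial of the remainder still
  contains one of \<open>x_1\<close>, ..., \<open>x_i\<close>, so it vanishes on \<open>Y_i\<close>.
  The instances \<open>k = d\<close> and \<open>k = i + 1\<close> serve the point and the
  divisor.\<close>

lemma local_equation_lin_coord:
  assumes inf: "infinite (UNIV :: 'k::field set)" and i: "i < k" "k \<le> d"
  shows "local_equation d (lin_subspace d k) (lin_subspace d i) (lin_subspace d (Suc i))
    (lin_coord i :: 'k poly_ring fract)"
  unfolding local_equation_def
proof (intro conjI ballI)
  note Z = subvariety_lin_subspace[OF inf i(2)]
  show "lin_coord i \<in> loc_ideal d (lin_subspace d k) (lin_subspace d (Suc i) :: 'k proj_point set)"
    unfolding lin_coord_def using i
    by (intro loc_idealI[of _ _ 1] forms_pvar pvar_vanishes_lin_subspace pvar_0_not_vanishes) auto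
  fix f assume "f \<in> loc_ideal d (lin_subspace d k) (lin_subspace d (Suc i) :: 'k proj_point set)"
  then obtain F G m where f: "f = Fract F G" "F \<in> forms d m" "G \<in> forms d m"
      "vanishes_on F (lin_subspace d (Suc i))" "\<not> vanishes_on G (lin_subspace d k)"
    by (rule loc_idealE)
  obtain A Q where Q: "F = A + pvar (Suc i) * Q" "A \<in> forms d m" "Q \<in> forms d (m - 1)" "m = 0 \<Longrightarrow> Q = 0"
      "Poly_Mapping.keys A = {\<mu> \<in> Poly_Mapping.keys F. Poly_Mapping.lookup \<mu> (Suc i) = 0}"
      "\<And>\<nu>. \<nu> \<in> Poly_Mapping.keys Q \<Longrightarrow> \<nu> + Poly_Mapping.single (Suc i) 1 \<in> Poly_Mapping.keys F"
    by (rule forms_split_pvar[OF f(2), of "Suc i"]) blast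
  have A: "vanishes_on A (lin_subspace d i)"
  proof (rule vanishes_on_lin_subspaceI)
    fix \<mu> assume "\<mu> \<in> Poly_Mapping.keys A"
    hence "\<mu> \<in> Poly_Mapping.keys F" "Suc i \<notin> Poly_Mapping.keys \<mu>"
      using Q(5) by (auto simp: in_keys_iff)
    thus "Poly_Mapping.keys \<mu> \<inter> {1..i} \<noteq> {}"
      using vanishes_on_lin_subspaceD[OF inf f(2,4)] by (auto simp: atLeastAtMostSuc_conv)
  qed
  have Q0: "Q * pvar 0 \<in> forms d m"
  proof (cases "m = 0")
    case False
    thus ?thesis using forms_mult[OF Q(3) forms_pvar[of 0 d]] by simp
  qed (use Q(4) in simp)
  show "\<exists>a\<in>loc_ring d (lin_subspace d k).
      f - a * lin_coord i \<in> loc_ideal d (lin_subspace d k) (lin_subspace d i :: 'k proj_point set)"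
  \<comment> \<open>The factor \<open>x_0\<close> cancels the denominator of
    \<open>lin_coord i\<close> and lifts \<open>Q\<close> to degree \<open>m\<close>.\<close>
  proof (rule bexI[of _ "Fract (Q * pvar 0) G"])
    have G: "G \<noteq> 0" using f(5) by auto
    have "Fract (Q * pvar 0) G * lin_coord i = Fract (pvar (Suc i) * Q) G"
      unfolding lin_coord_def mult_fract using G pvar_0_nonzero
      by (subst eq_fract(1)) (auto simp: mult_ac)
    hence "f - Fract (Q * pvar 0) G * lin_coord i = Fract A G"
      using G by (simp add: f(1) Q(1) eq_fract(1) algebra_simps)
    thus "f - Fract (Q * pvar 0) G * lin_coord i \<in> loc_ideal d (lin_subspace d k) (lin_subspace d i)"
      using loc_idealI[OF Q(2) f(3) A f(5)] by simp
    show "Fract (Q * pvar 0) G \<in> loc_ring d (lin_subspace d k)"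
      using Q0 f(3,5) by (rule loc_ringI)
  qed
qed

text \<open>Local equations are split off one at a time; each remainder lies in the ideal of the
  next larger subspace.\<close>

lemma loc_ideal_lin_subspace_generators:
  assumes inf: "infinite (UNIV :: 'k::field set)" and "i + n \<le> d"
    and "f \<in> loc_ideal d (lin_subspace d d) (lin_subspace d (i + n) :: 'k proj_point set)"
  shows "\<exists>a. (\<forall>l<n. a l \<in> loc_ring d (lin_subspace d d)) \<and>
    f - (\<Sum>l<n. a l * lin_coord (i + l)) \<in> loc_ideal d (lin_subspace d d) (lin_subspace d i)"
  using assms(2,3)
proof (induction n arbitrary: f)
  case 0
  thus ?case by simp
next
  case (Suc n)
  have "local_equation d (lin_subspace d d) (lin_subspace d (i + n)) (lin_subspace d (Suc (i + n)))
      (lin_coord (i + n) :: 'k poly_ring fract)"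
    using Suc.prems by (intro local_equation_lin_coord[OF inf]) auto
  then obtain b where b: "b \<in> loc_ring d (lin_subspace d d)"
      "f - b * lin_coord (i + n) \<in> loc_ideal d (lin_subspace d d) (lin_subspace d (i + n))"
    using Suc.prems by (auto simp: local_equation_def)
  obtain a where a: "\<forall>l<n. a l \<in> loc_ring d (lin_subspace d d)"
      "f - b * lin_coord (i + n) - (\<Sum>l<n. a l * lin_coord (i + l))
        \<in> loc_ideal d (lin_subspace d d) (lin_subspace d i)"
    using Suc.IH[OF _ b(2)] Suc.prems by auto
  have "(\<Sum>l<n. (a(n := b)) l * lin_coord (i + l)) = (\<Sum>l<n. a l * lin_coord (i + l))"
    by (intro sum.cong) auto
  thus ?case using a b by (intro exI[of _ "a(n := b)"]) (auto simp: algebra_simps less_Suc_eq)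
qed

text \<open>The remaining \<open>d - i\<close> affine coordinates form a regular system of
  parameters.\<close>

lemma nonsingular_lin_subspace:
  assumes inf: "infinite (UNIV :: 'k::field set)" and i: "i \<le> d"
    and P: "lin_subspace d d = {P :: 'k proj_point}"
  shows "nonsingular_at d (lin_subspace d i) P"
  unfolding nonsingular_at_def P[symmetric]
proof (rule exI[of _ "d - i"], rule exI[of _ "\<lambda>l. lin_coord (i + l)"], intro conjI allI impI ballI)
  show "codim d (lin_subspace d d) (lin_subspace d i :: 'k proj_point set) = enat (d - i)"
    using codim_lin_subspace[OF inf, of i "d - i" d] i by simp
  show "lin_coord (i + l) \<in> loc_ideal d (lin_subspace d d) (lin_subspace d d :: 'k proj_point set)"
    if "l < d - i" for l
    unfolding lin_coord_def using that
    by (intro loc_idealI[of _ _ 1] forms_pvar pvar_vanishes_lin_subspace pvar_0_not_vanishes) auto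
  show "\<exists>a. (\<forall>l<d - i. a l \<in> loc_ring d (lin_subspace d d)) \<and>
      f - (\<Sum>l<d - i. a l * lin_coord (i + l)) \<in> loc_ideal d (lin_subspace d d) (lin_subspace d i)"
    if "f \<in> loc_ideal d (lin_subspace d d) (lin_subspace d d :: 'k proj_point set)" for f
    using loc_ideal_lin_subspace_generators[OF inf, of i "d - i" d f] that i by simp
qed

lemma admissible_flag_lin_subspace:
  assumes inf: "infinite (UNIV :: 'k::field set)"
  shows "admissible_flag d (lin_subspace d :: nat \<Rightarrow> 'k proj_point set)"
proof -
  let ?P = "proj_pt (\<lambda>l. if l = 0 then 1 else 0) :: 'k proj_point"
  have "codim d (lin_subspace d i) (proj_space d :: 'k proj_point set) = enat i" if "i \<le> d" for i
    using codim_lin_subspace[OF inf, of 0 i d] that by (simp add: lin_subspace_0)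
  moreover have "nonsingular_at d (lin_subspace d i) ?P" if "i \<le> d" for i
    using nonsingular_lin_subspace[OF inf that lin_subspace_point] .
  moreover have "lin_subspace d (Suc i) \<subseteq> (lin_subspace d i :: 'k proj_point set)" for i
    by (rule lin_subspace_mono) simp
  ultimately show ?thesis
    unfolding admissible_flag_def
    using subvariety_lin_subspace[OF inf] lin_subspace_0 lin_subspace_point by metis
qed

section \<open>The valuation of the linear flag\<close>

text \<open>Extracts the exact power of \<open>x_j\<close>: while no monomial is free of
  \<open>x_j\<close>, divide once more, which lowers the degree. A nonzero \<open>A\<close>
  certifies that \<open>k\<close> is maximal.\<close>

lemma forms_factor_pvar_power:
  assumes "h \<in> forms d e" "h \<noteq> 0"
  shows "\<exists>k A Q. h = pvar j ^ k * (A + pvar j * Q) \<and> A \<noteq> 0 \<and> k \<le> e \<and> A \<in> forms d (e - k) \<and>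
    A + pvar j * Q \<in> forms d (e - k) \<and>
    (\<forall>\<mu>\<in>Poly_Mapping.keys A. Poly_Mapping.lookup \<mu> j = 0 \<and> \<mu> + Poly_Mapping.single j k \<in> Poly_Mapping.keys h)"
  using assms
proof (induction e arbitrary: h)
  case 0
  obtain A Q where Q: "h = A + pvar j * Q" "A \<in> forms d 0" "Q \<in> forms d (0 - 1)" "0 = (0 :: nat) \<Longrightarrow> Q = 0"
      "Poly_Mapping.keys A = {\<mu> \<in> Poly_Mapping.keys h. Poly_Mapping.lookup \<mu> j = 0}"
      "\<And>\<nu>. \<nu> \<in> Poly_Mapping.keys Q \<Longrightarrow> \<nu> + Poly_Mapping.single j 1 \<in> Poly_Mapping.keys h"
    by (rule forms_split_pvar[OF "0.prems"(1), of j]) blast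
  show ?case
    using Q(1-5) 0 by (intro exI[of _ 0] exI[of _ A] exI[of _ Q]) auto
next
  case (Suc e)
  obtain A Q where Q: "h = A + pvar j * Q" "A \<in> forms d (Suc e)" "Q \<in> forms d (Suc e - 1)" "Suc e = 0 \<Longrightarrow> Q = 0"
      "Poly_Mapping.keys A = {\<mu> \<in> Poly_Mapping.keys h. Poly_Mapping.lookup \<mu> j = 0}"
      "\<And>\<nu>. \<nu> \<in> Poly_Mapping.keys Q \<Longrightarrow> \<nu> + Poly_Mapping.single j 1 \<in> Poly_Mapping.keys h"
    by (rule forms_split_pvar[OF Suc.prems(1), of j]) blast
  show ?case
  proof (cases "A = 0")
    case False
    thus ?thesis
      using Q(1,2,5) Suc.prems by (intro exI[of _ 0] exI[of _ A] exI[of _ Q]) auto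
  next
    case True
    hence h: "h = pvar j * Q" using Q(1) by simp
    hence "Q \<noteq> 0" using Suc.prems by auto
    moreover have "Q \<in> forms d e" using Q(3) by simp
    ultimately obtain k A' Q' where *: "Q = pvar j ^ k * (A' + pvar j * Q')" "A' \<noteq> 0" "k \<le> e"
        "A' \<in> forms d (e - k)" "A' + pvar j * Q' \<in> forms d (e - k)"
        "\<And>\<mu>. \<mu> \<in> Poly_Mapping.keys A' \<Longrightarrow> Poly_Mapping.lookup \<mu> j = 0"
        "\<And>\<mu>. \<mu> \<in> Poly_Mapping.keys A' \<Longrightarrow> \<mu> + Poly_Mapping.single j k \<in> Poly_Mapping.keys Q"
      using Suc.IH[of Q] by blast
    have "\<mu> + Poly_Mapping.single j (Suc k) \<in> Poly_Mapping.keys h" if "\<mu> \<in> Poly_Mapping.keys A'" for \<mu>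
      using Q(6)[OF *(7)[OF that]] by (simp add: add.assoc flip: single_add)
    thus ?thesis using * h
      by (intro exI[of _ "Suc k"] exI[of _ A'] exI[of _ Q']) (auto simp: mult.assoc)
  qed
qed

text \<open>The successive restrictions are determined by the flag only up to units \<open>w\<close> of the local ring at
  the point, so they are tracked up to such units.\<close>

definition germ_rep :: "nat \<Rightarrow> nat \<Rightarrow> 'k::field poly_ring fract \<Rightarrow> 'k poly_ring \<Rightarrow> nat \<Rightarrow> bool" where
  "germ_rep d i g h e \<longleftrightarrow> g \<in> loc_ring d (lin_subspace d d) \<and> h \<noteq> 0 \<and> h \<in> forms d e \<and>
     (\<forall>\<mu>\<in>Poly_Mapping.keys h. Poly_Mapping.keys \<mu> \<inter> {1..i} = {}) \<and>
     (\<exists>w. w \<in> loc_ring d (lin_subspace d d) \<and> w \<notin> loc_ideal d (lin_subspace d d) (lin_subspace d d) \<and>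
        w * g - Fract h (pvar 0 ^ e) \<in> loc_ideal d (lin_subspace d d) (lin_subspace d i))"

text \<open>The predicate under \<open>SOME\<close> in \<open>flag_germ\<close> for the linear flag,
  with the order as parameter \<open>k\<close>; a name for it allows statements about all
  candidates.\<close>

definition is_next_germ :: "nat \<Rightarrow> nat \<Rightarrow> 'k::field poly_ring fract \<Rightarrow> nat \<Rightarrow> 'k poly_ring fract \<Rightarrow> bool" where
  "is_next_germ d i g k g' \<longleftrightarrow> g' \<in> loc_ring d (lin_subspace d d) \<and>
     (\<exists>t. local_equation d (lin_subspace d d) (lin_subspace d i) (lin_subspace d (Suc i)) t \<and>
        g - t ^ k * g' \<in> loc_ideal d (lin_subspace d d) (lin_subspace d i))"

text \<open>Factor \<open>h\<close> as \<open>x_(i+1) ^ k\<close> times a cofactor that equals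
  \<open>A\<close>, nonzero, on \<open>Y_(i+1)\<close>. Then \<open>k\<close> is the order, and
  since local equations differ by units modulo the ideal of \<open>Y_i\<close>, every candidate is
  represented by \<open>A\<close>.\<close>

lemma germ_rep_step:
  fixes g :: "'k::field poly_ring fract"
  assumes inf: "infinite (UNIV :: 'k set)" and i: "i < d" and rep: "germ_rep d i g h e"
  obtains k A where "ord_along d (lin_subspace d i) (lin_subspace d (Suc i)) g = k"
    "\<exists>g'. is_next_germ d i g k g'" "\<And>g'. is_next_germ d i g k g' \<Longrightarrow> germ_rep d (Suc i) g' A (e - k)"
    "\<And>\<mu>. \<mu> \<in> Poly_Mapping.keys A \<Longrightarrow> \<mu> + Poly_Mapping.single (Suc i) k \<in> Poly_Mapping.keys h"
proof -
  let ?L = "lin_subspace d :: nat \<Rightarrow> 'k proj_point set"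
  let ?R = "loc_ring d (?L d)" and ?I = "\<lambda>l. loc_ideal d (?L d) (?L l)"
  have var: "subvariety d (?L l)" if "l \<le> d" for l using subvariety_lin_subspace[OF inf that] .
  note Z = var[OF order_refl]
  have Ld: "?L d \<subseteq> ?L l" if "l \<le> d" for l using lin_subspace_mono[OF that] .
  note vi = var[OF less_imp_le[OF i]] and Li = Ld[OF less_imp_le[OF i]]
  have strict: "?L (Suc i) \<subset> ?L i" using lin_subspace_strict[OF i] .
  obtain w where h: "g \<in> ?R" "h \<noteq> 0" "h \<in> forms d e"
      "\<forall>\<mu>\<in>Poly_Mapping.keys h. Poly_Mapping.keys \<mu> \<inter> {1..i} = {}"
      and w: "w \<in> ?R" "w \<notin> ?I d" "w * g - Fract h (pvar 0 ^ e) \<in> ?I i"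
    using rep unfolding germ_rep_def by blast
  obtain k A Q where fac: "h = pvar (Suc i) ^ k * (A + pvar (Suc i) * Q)" and A: "A \<noteq> 0"
      and k: "k \<le> e" and Af: "A \<in> forms d (e - k)" and Hf: "A + pvar (Suc i) * Q \<in> forms d (e - k)"
      and Ak: "\<And>\<mu>. \<mu> \<in> Poly_Mapping.keys A \<Longrightarrow> Poly_Mapping.lookup \<mu> (Suc i) = 0"
        "\<And>\<mu>. \<mu> \<in> Poly_Mapping.keys A \<Longrightarrow> \<mu> + Poly_Mapping.single (Suc i) k \<in> Poly_Mapping.keys h"
    using forms_factor_pvar_power[OF h(3,2), of "Suc i"] by blast
  define H where "H = A + pvar (Suc i) * Q"
  define x where "x = (lin_coord i :: 'k poly_ring fract)"
  define hh where "hh = Fract H (pvar 0 ^ (e - k))"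
  define AA where "AA = Fract A (pvar 0 ^ (e - k))"
  have Hforms: "H \<in> forms d (e - k)" using Hf by (simp add: H_def)
  have keysA: "Poly_Mapping.keys \<mu> \<inter> {1..Suc i} = {}" if "\<mu> \<in> Poly_Mapping.keys A" for \<mu>
  proof -
    have "Suc i \<notin> Poly_Mapping.keys \<mu>" using Ak(1)[OF that] by (simp add: in_keys_iff)
    moreover have "Poly_Mapping.keys (\<mu> + Poly_Mapping.single (Suc i) k) \<inter> {1..i} = {}"
      using h(4) Ak(2)[OF that] by blast
    hence "Poly_Mapping.keys \<mu> \<inter> {1..i} = {}" unfolding keys_add_nat by blast
    ultimately show ?thesis by (simp add: atLeastAtMostSuc_conv)
  qed
  have AnvL: "\<not> vanishes_on A (?L (Suc i))"
  proof
    assume van: "vanishes_on A (?L (Suc i))"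
    obtain \<mu> where "\<mu> \<in> Poly_Mapping.keys A" using A keys_eq_empty_iff[of A] by blast
    thus False using vanishes_on_lin_subspaceD[OF inf Af van] keysA by blast
  qed
  have xQ: "vanishes_on (pvar (Suc i) * Q) (?L (Suc i))"
    by (intro vanishes_on_mult disjI1 pvar_vanishes_lin_subspace) simp
  have HnvL: "\<not> vanishes_on H (?L (Suc i))"
    using vanishes_on_diff[OF _ xQ, of H] AnvL by (auto simp: H_def)
  have hhR: "hh \<in> ?R" unfolding hh_def using Hforms pvar_0_power by (rule loc_ringI)
  have hh_AA: "hh - AA \<in> ?I (Suc i)"
  proof -
    have "hh - AA = Fract (pvar (Suc i) * Q) (pvar 0 ^ (e - k))"
      using pvar_0_nonzero[where ?'k = 'k] by (simp add: hh_def AA_def H_def eq_fract(1) algebra_simps)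
    moreover have "pvar (Suc i) * Q \<in> forms d (e - k)"
      using forms_diff[OF Hforms Af] by (simp add: H_def)
    ultimately show ?thesis using loc_idealI[OF _ pvar_0_power(1) xQ pvar_0_power(2)] by simp
  qed
  have x_loc: "local_equation d (?L l) (?L i) (?L (Suc i)) x" if "i < l" "l \<le> d" for l
    unfolding x_def using local_equation_lin_coord[OF inf that] .
  have xI: "x \<in> ?I (Suc i)" using x_loc[OF i] by (simp add: local_equation_def)
  hence xR: "x \<in> ?R" using loc_ideal_subset_ring by blast
  have xnI: "x \<notin> ?I i"
    using local_equation_not_in_ideal[OF var var Z Ld strict x_loc[OF i]] i by simp
  have xh: "Fract h (pvar 0 ^ e) = x ^ k * hh"
  proof -
    have "x ^ k = Fract (pvar (Suc i) ^ k) (pvar 0 ^ k)"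
      unfolding x_def lin_coord_def by (induction k) (simp_all add: One_fract_def)
    moreover have "(pvar 0 :: 'k poly_ring) ^ e = pvar 0 ^ k * pvar 0 ^ (e - k)"
      using k by (simp flip: power_add)
    ultimately show ?thesis by (simp add: fac hh_def H_def)
  qed
  have wgx: "w * g - x ^ k * hh \<in> ?I i" using w(3) by (simp add: xh)
  have wi: "inverse w \<in> ?R" "w \<noteq> 0" using loc_ring_inverse[OF w(1,2)] by auto
  have gx: "g - x ^ k * (inverse w * hh) \<in> ?I i"
  proof -
    have "g - x ^ k * (inverse w * hh) = inverse w * (w * g - x ^ k * hh)"
      using wi(2) by (simp add: field_simps)
    thus ?thesis using loc_ideal_mult[OF Z wi(1) wgx] by simp
  qed
  have uR: "inverse w * hh \<in> ?R" using loc_ring_mult[OF Z wi(1) hhR] .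

  have ord: "ord_along d (?L i) (?L (Suc i)) g = k"
  proof (rule ord_along_eqI[OF var var strict x_loc])
    \<comment> \<open>The expansion found at the point is reused in the larger local ring along
      \<open>Y_(i+1)\<close>.\<close>
    have RS: "?R \<subseteq> loc_ring d (?L (Suc i))" using Ld i by (intro loc_ring_mono) simp
    show "inverse w * hh \<in> loc_ring d (?L (Suc i))" using uR RS by blast
    show "g - inverse w * hh * x ^ k \<in> loc_ideal d (?L (Suc i)) (?L i)"
    proof -
      have "loc_ideal d (?L d) (?L i) \<subseteq> loc_ideal d (?L (Suc i)) (?L i)"
        using Ld[of "Suc i"] i by (intro loc_ideal_mono) simp_all
      thus ?thesis using gx by (simp only: mult_ac) blast
    qed
    \<comment> \<open>\<open>hh\<close> may vanish at the point; it only has to be a unit along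
      \<open>Y_(i+1)\<close>.\<close>
    show "inverse w * hh \<notin> loc_ideal d (?L (Suc i)) (?L (Suc i))"
    proof
      assume "inverse w * hh \<in> loc_ideal d (?L (Suc i)) (?L (Suc i))"
      hence "w * (inverse w * hh) \<in> loc_ideal d (?L (Suc i)) (?L (Suc i))"
        using i by (intro loc_ideal_mult[OF var subsetD[OF RS w(1)]]) simp_all
      hence "hh \<in> loc_ideal d (?L (Suc i)) (?L (Suc i))" using wi(2) by (simp flip: mult.assoc)
      thus False unfolding hh_def using i HnvL
        by (subst (asm) Fract_in_loc_ideal_iff[OF var order_refl Hforms pvar_0_power]) auto
    qed
  qed (use i in auto)
  have ex: "is_next_germ d i g k (inverse w * hh)"
    unfolding is_next_germ_def using uR gx x_loc[OF i] by blast
  have all: "germ_rep d (Suc i) g' A (e - k)" if "is_next_germ d i g k g'" for g'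
  proof -
    obtain t where g': "g' \<in> ?R" and t: "local_equation d (?L d) (?L i) (?L (Suc i)) t" "g - t ^ k * g' \<in> ?I i"
      using \<open>is_next_germ d i g k g'\<close> unfolding is_next_germ_def by (elim conjE exE)
    have tI: "t \<in> ?I (Suc i)" using t by (simp add: local_equation_def)
    hence tR: "t \<in> ?R" using loc_ideal_subset_ring by blast
    obtain a where a: "a \<in> ?R" "t - a * x \<in> ?I i" using tI x_loc[OF i] by (auto simp: local_equation_def)
    obtain b where b: "b \<in> ?R" "x - b * t \<in> ?I i" using xI t(1) by (auto simp: local_equation_def)
    \<comment> \<open>Cancelling \<open>x\<close> gives \<open>a * b = 1\<close> modulo the ideal of
      \<open>Y_i\<close>, so \<open>a\<close> is a unit at the point and \<open>w * a ^ k\<close>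
      can be the new unit.\<close>
    have "x * (1 - a * b) = (x - b * t) + b * (t - a * x)" by (simp add: algebra_simps)
    hence "x * (1 - a * b) \<in> ?I i" using loc_ideal_add[OF Z b(2) loc_ideal_mult[OF Z b(1) a(2)]] by simp
    hence "1 - a * b \<in> ?I i"
      using loc_ideal_prime[OF vi Z Li xR loc_ring_diff[OF Z one_in_loc_ring[OF Z] loc_ring_mult[OF Z a(1) b(1)]]]
        xnI by blast
    hence ab: "1 - b * a \<in> ?I d" using loc_ideal_mono[OF order_refl Li] unfolding mult.commute[of b a] by blast
    have anI: "a \<notin> ?I d"
      using loc_ideal_diff_cancel[OF Z ab loc_ideal_mult[OF Z b(1)]] one_not_in_loc_ideal[OF Z Z order_refl] by blast
    define w' where "w' = w * a ^ k"
    have akR: "a ^ k \<in> ?R" using loc_ring_power[OF Z a(1)] .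
    have w'R: "w' \<in> ?R" unfolding w'_def by (rule loc_ring_mult[OF Z w(1) akR])
    have w'n: "w' \<notin> ?I d"
      using loc_ideal_prime[OF Z Z order_refl w(1) akR] loc_ideal_prime_power[OF Z Z order_refl a(1)] w(2) anI
      unfolding w'_def by blast
    have tax: "t ^ k - (a * x) ^ k \<in> ?I i"
      by (rule loc_ideal_power_diff[OF Z tR loc_ring_mult[OF Z a(1) xR] a(2)])
    \<comment> \<open>Combines the known congruences so that \<open>x ^ k\<close> can be cancelled
      by primality.\<close>
    have "x ^ k * (w' * g' - hh) = (w * g - x ^ k * hh) - (w * g') * (t ^ k - (a * x) ^ k) - w * (g - t ^ k * g')"
      by (simp add: w'_def algebra_simps)
    hence "x ^ k * (w' * g' - hh) \<in> ?I i"
      using loc_ideal_diff[OF Z loc_ideal_diff[OF Z wgx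
          loc_ideal_mult[OF Z loc_ring_mult[OF Z w(1) g'] tax]] loc_ideal_mult[OF Z w(1) t(2)]] by simp
    hence "x ^ k \<in> ?I i \<or> w' * g' - hh \<in> ?I i"
      by (intro loc_ideal_prime[OF vi Z Li] loc_ring_power[OF Z xR]
          loc_ring_diff[OF Z] loc_ring_mult[OF Z] w'R g' hhR)
    moreover have "x ^ k \<notin> ?I i" using loc_ideal_prime_power[OF vi Z Li xR] xnI by blast
    \<comment> \<open>Modulo the larger ideal of \<open>Y_(i+1)\<close>, \<open>hh\<close> may be
      replaced by \<open>AA\<close>.\<close>
    ultimately have "w' * g' - hh \<in> ?I (Suc i)" using loc_ideal_mono[OF order_refl] strict by blast
    hence "w' * g' - AA \<in> ?I (Suc i)" using loc_ideal_add[OF Z _ hh_AA] by fastforce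
    thus ?thesis unfolding germ_rep_def AA_def using g' A Af keysA w'R w'n by blast
  qed
  show ?thesis by (rule that[OF ord _ all Ak(2)]) (use ex in blast)+
qed

text \<open>Each step removes a power of one variable; adding the removed powers back to an exponent
  of \<open>h\<close> gives an exponent of \<open>s\<close>.\<close>

lemma flag_germ_rep:
  fixes s :: "'k::field poly_ring"
  assumes inf: "infinite (UNIV :: 'k set)" and s: "s \<in> forms d m" "s \<noteq> 0" and "i \<le> d"
  shows "\<exists>h e. germ_rep d i (flag_germ d (lin_subspace d) m s i) h e \<and>
    (\<forall>\<mu>\<in>Poly_Mapping.keys h. \<mu> + (\<Sum>l<i. Poly_Mapping.single (Suc l) (flag_val d (lin_subspace d) m s l))
      \<in> Poly_Mapping.keys s)"
  using \<open>i \<le> d\<close>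
proof (induction i)
  case 0
  let ?L = "lin_subspace d :: nat \<Rightarrow> 'k proj_point set"
  note Z = subvariety_lin_subspace[OF inf order_refl, of d]
  \<comment> \<open>\<open>x_0\<close> is nonzero at the point, so \<open>trivialize\<close> divides
    by its \<open>m\<close>-th power and the initial unit is 1.\<close>
  have "(LEAST j. \<not> vanishes_on (pvar j) (?L d)) = 0"
    using pvar_0_not_vanishes by (intro Least_equality) auto
  hence g: "flag_germ d ?L m s 0 = Fract s (pvar 0 ^ m)" by (simp add: trivialize_def)
  have R: "Fract s (pvar 0 ^ m) \<in> loc_ring d (?L d)" using s(1) pvar_0_power by (rule loc_ringI)
  have "(0 :: 'k poly_ring fract) \<in> loc_ideal d (?L d) (?L 0)"
    using loc_idealI[OF zero_in_forms pvar_0_power(1)[of 0] vanishes_on_0 pvar_0_power(2)[of 0], of d d d "?L 0"]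
    by (simp add: Zero_fract_def)
  hence "germ_rep d 0 (flag_germ d ?L m s 0) s m"
    unfolding germ_rep_def g using R s one_in_loc_ring[OF Z] one_not_in_loc_ideal[OF Z Z order_refl]
    by (auto intro!: exI[of _ 1])
  thus ?case by fastforce
next
  case (Suc i)
  let ?L = "lin_subspace d :: nat \<Rightarrow> 'k proj_point set"
  let ?g = "flag_germ d ?L m s" and ?k = "flag_val d ?L m s"
  obtain h e where h: "germ_rep d i (?g i) h e" "\<And>\<mu>. \<mu> \<in> Poly_Mapping.keys h \<Longrightarrow>
      \<mu> + (\<Sum>l<i. Poly_Mapping.single (Suc l) (?k l)) \<in> Poly_Mapping.keys s"
    using Suc by auto
  have "i < d" using Suc.prems by simp
  then obtain k A where k: "ord_along d (?L i) (?L (Suc i)) (?g i) = k" "\<exists>g'. is_next_germ d i (?g i) k g'"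
      "\<And>g'. is_next_germ d i (?g i) k g' \<Longrightarrow> germ_rep d (Suc i) g' A (e - k)"
      "\<And>\<mu>. \<mu> \<in> Poly_Mapping.keys A \<Longrightarrow> \<mu> + Poly_Mapping.single (Suc i) k \<in> Poly_Mapping.keys h"
    using germ_rep_step[OF inf _ h(1)] by metis
  have "?g (Suc i) = (SOME g'. is_next_germ d i (?g i) k g')"
    by (simp add: is_next_germ_def k(1))
  hence "is_next_germ d i (?g i) k (?g (Suc i))" using someI_ex[OF k(2)] by simp
  hence "germ_rep d (Suc i) (?g (Suc i)) A (e - k)" by (rule k(3))
  moreover have "\<mu> + (\<Sum>l<Suc i. Poly_Mapping.single (Suc l) (?k l)) \<in> Poly_Mapping.keys s"
    if "\<mu> \<in> Poly_Mapping.keys A" for \<mu>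
  proof -
    have "?k i = k" by (simp add: flag_val_def k(1))
    thus ?thesis using h(2)[OF k(4)[OF that]] by (simp add: add_ac)
  qed
  ultimately show ?case by blast
qed

text \<open>The exponent is in fact the lexicographically smallest one; only its occurrence in \<open>s\<close> matters.\<close>

lemma flag_val_exponent:
  fixes s :: "'k::field poly_ring"
  assumes inf: "infinite (UNIV :: 'k set)" and s: "s \<in> forms d m" "s \<noteq> 0"
  obtains \<mu> where "\<mu> \<in> Poly_Mapping.keys s"
    "\<And>i. i < d \<Longrightarrow> flag_val d (lin_subspace d) m s i = Poly_Mapping.lookup \<mu> (Suc i)"
proof -
  let ?k = "flag_val d (lin_subspace d) m s"
  let ?S = "\<Sum>l<d. Poly_Mapping.single (Suc l) (?k l)"
  obtain h e where h: "germ_rep d d (flag_germ d (lin_subspace d) m s d) h e"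
      "\<And>\<mu>. \<mu> \<in> Poly_Mapping.keys h \<Longrightarrow> \<mu> + ?S \<in> Poly_Mapping.keys s"
    using flag_germ_rep[OF inf s order_refl] by blast
  have "h \<noteq> 0" using h(1) by (simp add: germ_rep_def)
  then obtain \<mu> where \<mu>: "\<mu> \<in> Poly_Mapping.keys h" using keys_eq_empty_iff[of h] by blast
  have "?k i = Poly_Mapping.lookup (\<mu> + ?S) (Suc i)" if "i < d" for i
  proof -
    \<comment> \<open>At the last stage \<open>h\<close> is free of \<open>x_1\<close>, ...,
      \<open>x_d\<close>, so these entries consist of the removed powers alone.\<close>
    have "Suc i \<in> {1..d}" using that by simp
    hence "Suc i \<notin> Poly_Mapping.keys \<mu>" using h(1) \<mu> unfolding germ_rep_def by blast
    moreover have "Poly_Mapping.lookup ?S (Suc i) = ?k i"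
      using that by (simp add: lookup_sum lookup_single when_def)
    ultimately show ?thesis by (simp add: lookup_add in_keys_iff)
  qed
  with h(2)[OF \<mu>] show ?thesis using that by blast
qed

section \<open>Monomial linear series and their Okounkov bodies\<close>

text \<open>The exponent of \<open>x_0\<close> is dropped; the degree determines it.\<close>

definition exponent_vec :: "(nat \<Rightarrow>\<^sub>0 nat) \<Rightarrow> real ^ 'n::{finite,linorder}" where
  "exponent_vec \<mu> = (\<chi> i. real (Poly_Mapping.lookup \<mu> (Suc (coord_no i))))"

text \<open>A condition on the support instead of a span, so that containment of exponents is
  immediate. For \<open>m = 0\<close> and nonempty \<open>K\<close> the dilate is the origin, which
  leaves the constants.\<close>

definition monomial_series :: "(real ^ 'n::{finite,linorder}) set \<Rightarrow> nat \<Rightarrow> 'k::field poly_ring set" where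
  "monomial_series K m = {p \<in> forms CARD('n) m. \<forall>\<mu>\<in>Poly_Mapping.keys p. exponent_vec \<mu> \<in> (*\<^sub>R) (real m) ` K}"

lemma coord_no_less: "coord_no (i :: 'n::{finite,linorder}) < CARD('n)"
  unfolding coord_no_def by (rule psubset_card_mono) auto

lemma coord_no_inj: "inj (coord_no :: 'n::{finite,linorder} \<Rightarrow> nat)"
proof -
  have "coord_no i < coord_no j" if "i < j" for i j :: 'n
    unfolding coord_no_def using that by (intro psubset_card_mono) (auto intro: less_trans)
  thus ?thesis by (intro linorder_injI) (metis less_irrefl)
qed

lemma coord_no_bij: "bij_betw (coord_no :: 'n::{finite,linorder} \<Rightarrow> nat) UNIV {..<CARD('n)}"
proof -
  have "coord_no ` (UNIV :: 'n set) \<subseteq> {..<CARD('n)}" using coord_no_less by auto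
  moreover have "card (coord_no ` (UNIV :: 'n set)) = CARD('n)" by (rule card_image[OF coord_no_inj])
  ultimately have "coord_no ` (UNIV :: 'n set) = {..<CARD('n)}" by (intro card_subset_eq) auto
  thus ?thesis using coord_no_inj by (simp add: bij_betw_def)
qed

lemma exponent_vec_add: "exponent_vec (\<mu> + \<nu>) = exponent_vec \<mu> + exponent_vec \<nu>"
  by (simp add: exponent_vec_def vec_eq_iff lookup_add)

lemma exponent_vec_0 [simp]: "exponent_vec 0 = 0"
  by (simp add: exponent_vec_def vec_eq_iff)

text \<open>A convex combination with weights \<open>a / (a + b)\<close> and
  \<open>b / (a + b)\<close>; this gives closure of the monomial series under products.\<close>

lemma convex_scale_add:
  assumes "convex K" "x \<in> (*\<^sub>R) a ` K" "y \<in> (*\<^sub>R) b ` K" "a \<ge> (0::real)" "b \<ge> 0"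
  shows "x + y \<in> (*\<^sub>R) (a + b) ` K"
proof -
  obtain u v where uv: "u \<in> K" "x = a *\<^sub>R u" "v \<in> K" "y = b *\<^sub>R v" using assms by blast
  show ?thesis
  proof (cases "a + b = 0")
    case True
    hence "a = 0" "b = 0" using assms by auto
    thus ?thesis using uv by auto
  next
    case False
    have "(a / (a + b)) *\<^sub>R u + (b / (a + b)) *\<^sub>R v \<in> K"
      using assms uv False by (intro convexD) (auto simp: divide_simps)
    moreover have "x + y = (a + b) *\<^sub>R ((a / (a + b)) *\<^sub>R u + (b / (a + b)) *\<^sub>R v)"
      using False uv by (simp add: scaleR_add_right)
    ultimately show ?thesis by blast
  qed
qed

lemma graded_linear_series_monomial_series:
  fixes K :: "(real ^ 'n::{finite,linorder}) set"
  assumes "convex K" "K \<noteq> {}"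
  shows "graded_linear_series CARD('n) (monomial_series K :: nat \<Rightarrow> 'k::field poly_ring set)"
proof -
  let ?W = "monomial_series K :: nat \<Rightarrow> 'k poly_ring set"
  let ?d = "CARD('n)"
  have sub: "mpoly_vs.subspace (?W m)" for m
  proof (rule mpoly_vs.subspaceI)
    show "p + q \<in> ?W m" if "p \<in> ?W m" "q \<in> ?W m" for p q
      using that keys_add[of p q] by (auto simp: monomial_series_def intro: forms_add)
    show "mpoly_scale c p \<in> ?W m" if p: "p \<in> ?W m" for c p
    proof -
      have k: "Poly_Mapping.keys (mpoly_scale c p) \<subseteq> Poly_Mapping.keys p"
        using keys_mult[of "Poly_Mapping.single 0 c" p] by (auto simp: mpoly_scale_def split: if_splits)
      hence "mpoly_scale c p \<in> forms ?d m" using p unfolding monomial_series_def forms_altdef by blast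
      thus ?thesis using p k unfolding monomial_series_def by blast
    qed
  qed (simp add: monomial_series_def)
  have fin: "\<exists>B. finite B \<and> ?W m = mpoly_vs.span B" for m
  proof -
    define M where "M = {\<mu>. Poly_Mapping.keys \<mu> \<subseteq> {..?d} \<and> total_degree \<mu> = m \<and>
      (exponent_vec \<mu> :: (real, 'n) vec) \<in> (*\<^sub>R) (real m) ` K}"
    let ?B = "(\<lambda>\<mu>. Poly_Mapping.single \<mu> (1::'k)) ` M"
    have "finite M" by (rule finite_subset[OF _ card_exponents_le(1)[of ?d m]]) (auto simp: M_def)
    moreover have "?W m = mpoly_vs.span ?B"
    proof
      show "mpoly_vs.span ?B \<subseteq> ?W m"
        by (rule mpoly_vs.span_minimal[OF _ sub]) (auto simp: M_def monomial_series_def intro: forms_single)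
      show "?W m \<subseteq> mpoly_vs.span ?B"
      proof
        fix p assume p: "p \<in> ?W m"
        have "(\<Sum>\<mu>\<in>Poly_Mapping.keys p. mpoly_scale (Poly_Mapping.lookup p \<mu>) (Poly_Mapping.single \<mu> 1))
            \<in> mpoly_vs.span ?B"
          using p by (intro mpoly_vs.span_sum mpoly_vs.span_scale mpoly_vs.span_base)
            (auto simp: monomial_series_def forms_altdef M_def)
        thus "p \<in> mpoly_vs.span ?B"
          using poly_mapping_eq_sum_single[of p] by (simp add: mpoly_scale_def mult_single)
      qed
    qed
    ultimately show ?thesis by blast
  qed
  have W0: "?W 0 = {Poly_Mapping.single 0 c | c. True}"
  proof
    show "?W 0 \<subseteq> {Poly_Mapping.single 0 c | c. True}"
    proof
      fix p assume "p \<in> ?W 0"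
      hence "Poly_Mapping.keys p \<subseteq> {0}" by (auto simp: monomial_series_def forms_altdef)
      hence "p = Poly_Mapping.single 0 (Poly_Mapping.lookup p 0)"
        by (intro poly_mapping_eqI) (auto simp: lookup_single when_def in_keys_iff)
      thus "p \<in> {Poly_Mapping.single 0 c | c. True}" by blast
    qed
    show "{Poly_Mapping.single 0 c | c. True} \<subseteq> ?W 0"
      using \<open>K \<noteq> {}\<close>
      by (auto simp: monomial_series_def forms_altdef image_constant_conv split: if_splits)
  qed
  have mult: "f * g \<in> ?W (k + l)" if f: "f \<in> ?W k" and g: "g \<in> ?W l" for k l f g
  proof -
    have "exponent_vec \<mu> \<in> (*\<^sub>R) (real (k + l)) ` K" if \<mu>: "\<mu> \<in> Poly_Mapping.keys (f * g)" for \<mu>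
    proof -
      obtain a b where ab: "\<mu> = a + b" "a \<in> Poly_Mapping.keys f" "b \<in> Poly_Mapping.keys g"
        using keys_mult[of f g] \<mu> by blast
      show ?thesis unfolding ab exponent_vec_add of_nat_add
        using f g ab by (intro convex_scale_add[OF \<open>convex K\<close>]) (auto simp: monomial_series_def)
    qed
    thus ?thesis using f g by (auto simp: monomial_series_def intro: forms_mult)
  qed
  show ?thesis
    unfolding graded_linear_series_def using sub fin W0 mult by (auto simp: monomial_series_def)
qed

section \<open>The two inclusions for the Okounkov body of a monomial series\<close>

lemma flag_val_vec_monomial_series:
  fixes K :: "(real ^ 'n::{finite,linorder}) set" and s :: "'k::field poly_ring"
  assumes inf: "infinite (UNIV :: 'k set)" and s: "s \<in> monomial_series K m" "s \<noteq> 0"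
  shows "flag_val_vec (lin_subspace CARD('n)) m s \<in> (*\<^sub>R) (real m) ` K"
proof -
  have "s \<in> forms CARD('n) m" using s by (simp add: monomial_series_def)
  then obtain \<mu> where \<mu>: "\<mu> \<in> Poly_Mapping.keys s"
      "\<And>i. i < CARD('n) \<Longrightarrow> flag_val CARD('n) (lin_subspace CARD('n)) m s i = Poly_Mapping.lookup \<mu> (Suc i)"
    using flag_val_exponent[OF inf _ s(2)] by blast
  have "flag_val_vec (lin_subspace CARD('n)) m s = (exponent_vec \<mu> :: (real, 'n) vec)"
    using \<mu>(2)[OF coord_no_less] by (simp add: flag_val_vec_def exponent_vec_def vec_eq_iff)
  thus ?thesis using \<mu>(1) s(1) by (simp add: monomial_series_def)
qed

text \<open>Realized by one monomial; the bound on the sum of \<open>a\<close> leaves a genuine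
  exponent for \<open>x_0\<close>.\<close>

lemma lattice_point_in_graded_semigroup:
  fixes K :: "(real ^ 'n::{finite,linorder}) set" and a :: "'n \<Rightarrow> nat"
  assumes inf: "infinite (UNIV :: 'k::field set)" and a: "(\<Sum>i\<in>UNIV. a i) \<le> m"
    and aK: "(\<chi> i. real (a i)) \<in> (*\<^sub>R) (real m) ` K"
  shows "((\<chi> i. real (a i)), real m) \<in>
    graded_semigroup (lin_subspace CARD('n)) (monomial_series K :: nat \<Rightarrow> 'k poly_ring set)"
proof -
  let ?d = "CARD('n)"
  define b where "b j = a (the_inv coord_no j)" for j
  have b: "b (coord_no i) = a i" for i by (simp add: b_def the_inv_f_f[OF coord_no_inj])
  have sum_b: "(\<Sum>j<?d. b j) = (\<Sum>i\<in>UNIV. a i)"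
    using sum.reindex_bij_betw[OF coord_no_bij[where ?'n = 'n], of b] by (simp add: b)
  define \<mu> where "\<mu> = Poly_Mapping.single 0 (m - (\<Sum>i\<in>UNIV. a i)) + (\<Sum>j<?d. Poly_Mapping.single (Suc j) (b j))"
  have lookup: "Poly_Mapping.lookup \<mu> (Suc j) = b j" if "j < ?d" for j
    using that by (simp add: \<mu>_def lookup_add lookup_sum lookup_single when_def)
  have td: "total_degree (\<Sum>j<n. Poly_Mapping.single (Suc j) (b j)) = (\<Sum>j<n. b j)" for n
    by (induction n) (simp_all add: total_degree_add)
  have "total_degree \<mu> = m"
    using a by (simp add: \<mu>_def total_degree_add td sum_b)
  moreover have "Poly_Mapping.keys \<mu> \<subseteq> {..?d}"
  proof
    fix j assume "j \<in> Poly_Mapping.keys \<mu>"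
    thus "j \<in> {..?d}"
      by (cases j) (auto simp: in_keys_iff \<mu>_def lookup_add lookup_sum lookup_single when_def split: if_splits)
  qed
  ultimately have "Poly_Mapping.single \<mu> (1::'k) \<in> forms ?d m" by (intro forms_single)
  moreover have ev: "exponent_vec \<mu> = (\<chi> i. real (a i))"
    by (simp add: exponent_vec_def vec_eq_iff lookup coord_no_less b)
  ultimately have s: "Poly_Mapping.single \<mu> (1::'k) \<in> monomial_series K m"
    using aK by (simp add: monomial_series_def)
  let ?s = "Poly_Mapping.single \<mu> (1::'k)"
  have s0: "?s \<noteq> 0" using keys_eq_empty_iff[of ?s] by simp
  obtain \<nu> where \<nu>: "\<nu> \<in> Poly_Mapping.keys ?s"
      "\<And>i. i < ?d \<Longrightarrow> flag_val ?d (lin_subspace ?d) m ?s i = Poly_Mapping.lookup \<nu> (Suc i)"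
    using flag_val_exponent[OF inf _ s0] \<open>?s \<in> forms ?d m\<close> by blast
  \<comment> \<open>Only one exponent occurs in \<open>?s\<close>, so knowing that the valuation
    occurs determines it.\<close>
  hence "\<nu> = \<mu>" by simp
  hence "flag_val_vec (lin_subspace ?d) m ?s = (\<chi> i. real (a i))"
    using \<nu>(2)[OF coord_no_less] by (simp add: flag_val_vec_def vec_eq_iff lookup coord_no_less b)
  thus ?thesis unfolding graded_semigroup_def using s s0
    by (intro CollectI exI[of _ m] exI[of _ ?s]) simp
qed

text \<open>The homogenization of a half-space containing \<open>K\<close> is a closed convex cone containing the graded
  semigroup.\<close>

lemma okounkov_body_monomial_series_subset:
  fixes K :: "(real ^ 'n::{finite,linorder}) set"
  assumes inf: "infinite (UNIV :: 'k::field set)" and K: "closed K" "convex K"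
  shows "okounkov_body (lin_subspace CARD('n)) (monomial_series K :: nat \<Rightarrow> 'k poly_ring set) \<subseteq> K"
proof
  let ?G = "graded_semigroup (lin_subspace CARD('n)) (monomial_series K :: nat \<Rightarrow> 'k poly_ring set)
    :: ((real, 'n) vec \<times> real) set"
  fix z :: "(real, 'n) vec"
  assume "z \<in> okounkov_body (lin_subspace CARD('n)) (monomial_series K :: nat \<Rightarrow> 'k poly_ring set)"
  hence z: "(z, 1) \<in> closure (convex_cone hull ?G)" by (simp add: okounkov_body_def)
  show "z \<in> K"
  proof (rule ccontr)
    assume "z \<notin> K"
    then obtain a b where ab: "a \<bullet> z < b" "\<forall>x\<in>K. b < a \<bullet> x"
      using separating_hyperplane_closed_point[OF K(2,1)] by blast
    define H where "H = {p :: (real, 'n) vec \<times> real. (a, - b) \<bullet> p \<ge> 0}"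
    have "?G \<subseteq> H"
    proof
      fix p assume "p \<in> ?G"
      then obtain m s where p: "p = (flag_val_vec (lin_subspace CARD('n)) m s, real m)"
          "s \<in> (monomial_series K m :: 'k poly_ring set)" "s \<noteq> 0"
        by (auto simp: graded_semigroup_def)
      obtain x where x: "x \<in> K" "flag_val_vec (lin_subspace CARD('n)) m s = real m *\<^sub>R x"
        using flag_val_vec_monomial_series[OF inf p(2,3)] by blast
      \<comment> \<open>Only the weak inequality survives, since \<open>m\<close> may be 0.\<close>
      have "real m * b \<le> real m * (a \<bullet> x)" using ab(2) x(1) by (intro mult_left_mono) auto
      thus "p \<in> H" by (simp add: H_def p(1) x(2) mult.commute)
    qed
    moreover have "convex_cone H"
      unfolding H_def convex_cone_def conic_def
      by (auto simp: convex_halfspace_ge inner_add_right intro!: exI[of _ 0])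
    moreover have "closed H" unfolding H_def by (rule closed_halfspace_ge)
    ultimately have "closure (convex_cone hull ?G) \<subseteq> H"
      by (intro closure_minimal hull_minimal)
    hence "(z, 1) \<in> H" using z by blast
    thus False using ab(1) by (simp add: H_def)
  qed
qed

lemma subset_okounkov_body_monomial_series:
  fixes K :: "(real ^ 'n::{finite,linorder}) set"
  assumes inf: "infinite (UNIV :: 'k::field set)" and K: "closed K" "convex K" "interior K \<noteq> {}"
    and simplex: "\<And>x i. x \<in> K \<Longrightarrow> 0 \<le> x $ i" "\<And>x. x \<in> K \<Longrightarrow> (\<Sum>i\<in>UNIV. x $ i) \<le> 1"
  shows "K \<subseteq> okounkov_body (lin_subspace CARD('n)) (monomial_series K :: nat \<Rightarrow> 'k poly_ring set)"
proof -
  let ?G = "graded_semigroup (lin_subspace CARD('n)) (monomial_series K :: nat \<Rightarrow> 'k poly_ring set)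
    :: ((real, 'n) vec \<times> real) set"
  let ?C = "closure (convex_cone hull ?G)"
  have int: "(x, 1) \<in> ?C" if x: "x \<in> interior K" for x
  proof -
    \<comment> \<open>Rounding down to denominator \<open>Suc m\<close>; nonnegativity of
      \<open>x\<close> makes \<open>nat\<close> harmless, and \<open>X m\<close> is eventually in
      the interior of \<open>K\<close>.\<close>
    define X where "X m = (\<chi> i. real (nat \<lfloor>real (Suc m) * x $ i\<rfloor>) / real (Suc m))" for m
    have x0: "0 \<le> x $ i" for i using simplex(1) x interior_subset by blast
    have lim: "X \<longlonglongrightarrow> x"
    proof (rule vec_tendstoI)
      fix i
      have fl: "real (nat \<lfloor>real (Suc m) * x $ i\<rfloor>) = of_int \<lfloor>real (Suc m) * x $ i\<rfloor>" for m
        using x0[of i] by simp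
      have "(\<lambda>m. x $ i - inverse (real (Suc m))) \<longlonglongrightarrow> x $ i - 0"
        by (intro tendsto_diff tendsto_const LIMSEQ_inverse_real_of_nat)
      hence lower: "(\<lambda>m. x $ i - 1 / real (Suc m)) \<longlonglongrightarrow> x $ i" by (simp only: inverse_eq_divide diff_0_right)
      have "x $ i - 1 / real (Suc m) \<le> X m $ i" for m
      proof -
        have "real (Suc m) * x $ i - 1 \<le> of_int \<lfloor>real (Suc m) * x $ i\<rfloor>" by linarith
        hence "(real (Suc m) * x $ i - 1) / real (Suc m) \<le> of_int \<lfloor>real (Suc m) * x $ i\<rfloor> / real (Suc m)"
          by (rule divide_right_mono) simp
        thus ?thesis by (simp only: X_def vec_lambda_beta fl) (simp add: diff_divide_distrib)
      qed
      moreover have "X m $ i \<le> x $ i" for m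
      proof -
        have "of_int \<lfloor>real (Suc m) * x $ i\<rfloor> / real (Suc m) \<le> (real (Suc m) * x $ i) / real (Suc m)"
          by (rule divide_right_mono) simp_all
        thus ?thesis by (simp only: X_def vec_lambda_beta fl) simp
      qed
      ultimately show "(\<lambda>m. X m $ i) \<longlonglongrightarrow> x $ i"
        by (intro tendsto_sandwich[OF _ _ lower tendsto_const] always_eventually) blast+
    qed
    have "eventually (\<lambda>m. X m \<in> interior K) sequentially"
      using lim x by (intro topological_tendstoD) auto
    hence "eventually (\<lambda>m. (X m, 1) \<in> convex_cone hull ?G) sequentially"
    proof eventually_elim
      case (elim m)
      define a where "a i = nat \<lfloor>real (Suc m) * x $ i\<rfloor>" for i
      have XK: "X m \<in> K" using elim interior_subset by blast
      have aX: "(\<chi> i. real (a i)) = real (Suc m) *\<^sub>R X m"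
        by (simp add: X_def a_def vec_eq_iff)
      have "real (\<Sum>i\<in>UNIV. a i) = real (Suc m) * (\<Sum>i\<in>UNIV. X m $ i)"
        unfolding sum_distrib_left of_nat_sum using aX by (intro sum.cong) (auto simp: vec_eq_iff)
      also have "\<dots> \<le> real (Suc m) * 1" using simplex(2)[OF XK] by (intro mult_left_mono) auto
      finally have "(\<Sum>i\<in>UNIV. a i) \<le> Suc m" unfolding mult_1_right of_nat_le_iff .
      hence "((\<chi> i. real (a i)), real (Suc m)) \<in> ?G"
        using aX XK by (intro lattice_point_in_graded_semigroup[OF inf]) auto
      hence "((\<chi> i. real (a i)), real (Suc m)) \<in> convex_cone hull ?G" by (rule hull_inc)
      \<comment> \<open>A cone allows scaling the lattice point at height \<open>Suc m\<close> back
        to height 1.\<close>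
      hence "(1 / real (Suc m)) *\<^sub>R ((\<chi> i. real (a i)), real (Suc m)) \<in> convex_cone hull ?G"
        by (intro convex_cone_hull_mul) auto
      thus "(X m, 1) \<in> convex_cone hull ?G" unfolding aX by simp
    qed
    hence ev: "eventually (\<lambda>m. (X m, 1) \<in> ?C) sequentially"
      by (rule eventually_mono) (rule subsetD[OF closure_subset])
    have "(\<lambda>m. (X m, 1)) \<longlonglongrightarrow> (x, 1)" using lim by (intro tendsto_Pair tendsto_const)
    thus ?thesis
      by (rule Lim_in_closed_set[OF closed_closure ev trivial_limit_sequentially])
  qed
  have "closed {x. (x, 1) \<in> ?C}"
    using closed_vimage[OF closed_closure, of "\<lambda>x. (x, 1)" "convex_cone hull ?G"]
    by (simp add: vimage_def continuous_on_Pair)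
  hence "closure (interior K) \<subseteq> {x. (x, 1) \<in> ?C}" using int by (intro closure_minimal) auto
  moreover have "closure (interior K) = K" using K convex_closure_interior[of K] by simp
  ultimately show ?thesis by (auto simp: okounkov_body_def)
qed

text \<open>Coordinates bounded by \<open>R\<close> are scaled into [-1/(2n), 1/(2n)] and shifted
  into [0, 1/n], where \<open>n\<close> is the dimension, so their sum is at most 1.\<close>

lemma rescale_into_simplex:
  fixes K :: "(real ^ 'n::finite) set"
  assumes "bounded K"
  obtains c v where "c > 0" "\<And>x i. x \<in> (\<lambda>x. c *\<^sub>R x + v) ` K \<Longrightarrow> 0 \<le> x $ i"
    "\<And>x. x \<in> (\<lambda>x. c *\<^sub>R x + v) ` K \<Longrightarrow> (\<Sum>i\<in>UNIV. x $ i) \<le> 1"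
proof -
  obtain R where R: "R > 0" "\<And>x. x \<in> K \<Longrightarrow> norm x \<le> R"
    using assms by (auto simp: bounded_pos)
  define n where "n = real CARD('n)"
  have n: "n > 0" by (simp add: n_def)
  define c where "c = 1 / (2 * R * n)"
  define v :: "real ^ 'n" where "v = (\<chi> i. 1 / (2 * n))"
  have c: "c > 0" using R n by (simp add: c_def)
  have comp: "0 \<le> (c *\<^sub>R x + v) $ i \<and> (c *\<^sub>R x + v) $ i \<le> 1 / n" if "x \<in> K" for x i
  proof -
    have "\<bar>x $ i\<bar> \<le> R" using component_le_norm_cart[of x i] R(2)[OF that] by linarith
    hence "c * \<bar>x $ i\<bar> \<le> c * R" using c by (intro mult_left_mono) auto
    also have "c * R = 1 / (2 * n)" using R by (simp add: c_def)
    finally have "\<bar>c * x $ i\<bar> \<le> 1 / (2 * n)" using c by (simp add: abs_mult)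
    moreover have "1 / (2 * n) + 1 / (2 * n) = 1 / n" by simp
    ultimately show ?thesis
      unfolding v_def vector_add_component vector_scaleR_component vec_lambda_beta real_scaleR_def
      by linarith
  qed
  show ?thesis
  proof (rule that[OF c])
    fix x i assume "x \<in> (\<lambda>x. c *\<^sub>R x + v) ` K"
    thus "0 \<le> x $ i" using comp by auto
  next
    fix x assume "x \<in> (\<lambda>x. c *\<^sub>R x + v) ` K"
    hence "(\<Sum>i\<in>UNIV. x $ i) \<le> (\<Sum>i\<in>(UNIV :: 'n set). 1 / n)" using comp by (intro sum_mono) auto
    thus "(\<Sum>i\<in>UNIV. x $ i) \<le> 1" by (simp add: n_def)
  qed
qed

theorem proposition1p17:
  fixes K :: "(real ^ 'n::{finite,linorder}) set"
  assumes "uncountable (UNIV :: 'k::alg_closed_field set)"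
    and "convex_body K"
  shows "\<exists>c v (W :: nat \<Rightarrow> 'k poly_ring set) (Y :: nat \<Rightarrow> 'k proj_point set).
           c > 0 \<and>
           graded_linear_series CARD('n) W \<and>
           admissible_flag CARD('n) Y \<and>
           (\<lambda>x. c *\<^sub>R x + v) ` K = okounkov_body Y W"
proof -
  have inf: "infinite (UNIV :: 'k set)" using assms(1) by (rule uncountable_infinite)
  have K: "compact K" "convex K" "interior K \<noteq> {}" using assms(2) by (auto simp: convex_body_def)
  obtain c v where c: "c > 0" and simplex: "\<And>x i. x \<in> (\<lambda>x. c *\<^sub>R x + v) ` K \<Longrightarrow> 0 \<le> x $ i"
      "\<And>x. x \<in> (\<lambda>x. c *\<^sub>R x + v) ` K \<Longrightarrow> (\<Sum>i\<in>UNIV. x $ i) \<le> 1"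
    using rescale_into_simplex[OF compact_imp_bounded[OF K(1)]] by blast
  define L where "L = (\<lambda>x. c *\<^sub>R x + v) ` K"
  have L_eq: "L = (\<lambda>x. v + c *\<^sub>R x) ` K" by (simp add: L_def add.commute)
  have L: "closed L" "convex L"
    unfolding L_eq using compact_affinity[OF K(1)] convex_affinity[OF K(2)] compact_imp_closed by blast+
  \<comment> \<open>The affine map with nonzero factor \<open>c\<close> is open, so the image keeps
    interior points.\<close>
  have "(\<lambda>x. v + c *\<^sub>R x) ` interior K \<subseteq> interior L"
    using open_affinity[OF open_interior[of K], of c v] c interior_subset
    by (intro interior_maximal) (auto simp: L_eq)
  hence L': "interior L \<noteq> {}" using K(3) by blast
  have "L = okounkov_body (lin_subspace CARD('n)) (monomial_series L :: nat \<Rightarrow> 'k poly_ring set)"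
    using okounkov_body_monomial_series_subset[OF inf L(1,2)]
      subset_okounkov_body_monomial_series[OF inf L L' simplex[folded L_def]] by blast
  moreover have "L \<noteq> {}" using L' interior_subset by blast
  ultimately show ?thesis
    using c graded_linear_series_monomial_series[OF L(2)] admissible_flag_lin_subspace[OF inf]
    unfolding L_def by blast
qed

end
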